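(* In the functional linear regression setting described in the context, assume $\mathbb{E}\|X\|^4<+\infty$, $\mathrm{Ker}(\Gamma)=\{0\}$ and $\sup_{s\ge c_n}|sf_n(s)-1|=o(1/\sqrt n)$. Then it is impossible for $\widehat\rho-\rho$ to converge in distribution, after normalization, to a non-degenerate random element in the norm topology of $H$: for any normalizing sequence of positive real numbers $\alpha_n\uparrow+\infty$, if $\alpha_n(\widehat\rho-\rho)$ converges in distribution for the norm topology of $H$, then its limit is a degenerate random element.
   Context: Model. $H$ is an infinite-dimensional real separable Hilbert space with inner product $\langle\cdot,\cdot\rangle$ and norm $\|\cdot\|$. $(X,Y)$ is a pair of random variables with $X$ valued in $H$, $Y$ valued in $\mathbb{R}$, $\mathbb{E}Y^2<\infty$, $\mathbb{E}X=0$, and covariance operator $\Gamma h=\mathbb{E}(\langle X,h\rangle X)$, $h\in H$. The eigenvalues of $\Gamma$ are all simple, $\lambda_1>\lambda_2>\dots>0$, with associated orthonormal eigenvectors $(e_j)_{j\ge1}$. It is assumed that $\sum_j\langle\mathbb{E}(XY),e_j\rangle^2/\lambda_j^2<\infty$, so that $\rho=\sum_j\lambda_j^{-1}\langle\mathbb{E}(XY),e_j\rangle e_j\in H$ and $Y=\langle\rho,X\rangle+\varepsilon$, where $\mathbb{E}(\varepsilon|X)=0$ and $\mathbb{E}(\varepsilon^2|X)=\sigma_\varepsilon^2$. The data $(X_i,Y_i)$, $i=1,\dots,n$, are i.i.d. copies of $(X,Y)$. Estimator. $\Gamma_n=\frac1n\sum_{i=1}^n\langle X_i,\cdot\rangle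 X_i$ has eigenvalues $\widehat\lambda_1\ge\widehat\lambda_2\ge\dots$ with orthonormal eigenvectors $\widehat e_j$; $\Delta_n=\frac1n\sum_{i=1}^nY_iX_i\in H$. Let $\delta_1=\lambda_1-\lambda_2$ and $\delta_j=\min(\lambda_j-\lambda_{j+1},\lambda_{j-1}-\lambda_j)$ for $j\ge2$. $(c_n)$ is a sequence of strictly positive numbers tending to $0$ with $c_n<\lambda_1$. $(f_n)$ is a sequence of positive functions with support $[c_n,+\infty)$ such that $f_n$ is decreasing on $[c_n,\lambda_1+\delta_1]$, $\lim_n\sup_{x\ge c_n}|xf_n(x)-1|=0$, and $f_n'(x)$ exists for $x\in[c_n,+\infty)$. Set $\Gamma_n^\dagger=\sum_{j=1}^nf_n(\widehat\lambda_j)\langle\widehat e_j,\cdot\rangle\widehat e_j$ and $\widehat\rho=\Gamma_n^\dagger\Delta_n$. A random element of $H$ is degenerate if it is almost surely equal to a constant.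
   Formalization: The noise variance σ_ε² is assumed strictly positive; without noise the claim fails, e.g. Gaussian X with very fast decaying λ_j, ρ=e_1 and s f_n(s)=1+sin(√n(s−λ_1))/n above a tiny c_n give a non-degenerate limit of n(ρ̂−ρ). *)

theory Defs
  imports "HOL-Probability.Probability" "HOL-Library.Landau_Symbols"
begin

text \<open>
  The Hilbert space is a type of sort \<open>{real_inner, banach, second_countable_topology}\<close>: a real
  complete inner product space that is separable. Sequences written with first index 1 on paper
  are indexed from 0 here, so \<open>lam j\<close>, \<open>e j\<close>, \<open>lhat n \<omega> j\<close>, \<open>ehat n \<omega> j\<close>, \<open>Xs i\<close>, \<open>Ys i\<close> carry
  the mathematical index \<open>j + 1\<close> resp. \<open>i + 1\<close>. The sample size \<open>n\<close> is not shifted.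
\<close>

definition covariance_op ::
  "'w measure \<Rightarrow> ('w \<Rightarrow> 'h::{real_inner, banach, second_countable_topology}) \<Rightarrow> 'h \<Rightarrow> 'h" where
  "covariance_op M X h = (\<integral>\<omega>. (X \<omega> \<bullet> h) *\<^sub>R X \<omega> \<partial>M)"

definition cross_cov ::
  "'w measure \<Rightarrow> ('w \<Rightarrow> 'h::{real_inner, banach, second_countable_topology}) \<Rightarrow> ('w \<Rightarrow> real) \<Rightarrow> 'h"
  where
  "cross_cov M X Y = (\<integral>\<omega>. Y \<omega> *\<^sub>R X \<omega> \<partial>M)"

text \<open>
  \<open>l\<close> lists in decreasing order the eigenvalues of \<open>T\<close> with orthonormal eigenvectors \<open>e\<close>. The last
  conjunct says that no nonzero eigenvalue is forgotten and that each occurs with its full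
  multiplicity. The eigenvalue 0 is exempt: for an empirical covariance operator the tail of \<open>e\<close> is
  an arbitrary orthonormal sequence in the kernel.
\<close>
definition eigensystem ::
  "('h::real_inner \<Rightarrow> 'h) \<Rightarrow> (nat \<Rightarrow> real) \<Rightarrow> (nat \<Rightarrow> 'h) \<Rightarrow> bool" where
  "eigensystem T l e \<longleftrightarrow>
     (\<forall>i j. e i \<bullet> e j = (if i = j then 1 else 0)) \<and>
     decseq l \<and>
     (\<forall>j. T (e j) = l j *\<^sub>R e j) \<and>
     (\<forall>\<mu> h. \<mu> \<noteq> 0 \<and> T h = \<mu> *\<^sub>R h \<longrightarrow> h \<in> span (e ` {j. l j = \<mu>}))"

definition slope ::
  "'w measure \<Rightarrow> ('w \<Rightarrow> 'h::{real_inner, banach, second_countable_topology}) \<Rightarrow> ('w \<Rightarrow> real) \<Rightarrow>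
   (nat \<Rightarrow> real) \<Rightarrow> (nat \<Rightarrow> 'h) \<Rightarrow> 'h" where
  "slope M X Y lam e = (\<Sum>j. ((cross_cov M X Y \<bullet> e j) / lam j) *\<^sub>R e j)"

definition model_error ::
  "'w measure \<Rightarrow> ('w \<Rightarrow> 'h::{real_inner, banach, second_countable_topology}) \<Rightarrow> ('w \<Rightarrow> real) \<Rightarrow>
   (nat \<Rightarrow> real) \<Rightarrow> (nat \<Rightarrow> 'h) \<Rightarrow> 'w \<Rightarrow> real" where
  "model_error M X Y lam e \<omega> = Y \<omega> - slope M X Y lam e \<bullet> X \<omega>"

text \<open>
  The conditional moments are taken with respect to the sigma-algebra generated by \<open>X\<close>.
  The noise level is strictly positive: without noise the non-convergence result is false.
\<close>
locale functional_linear_model = prob_space M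
  for M :: "'w measure" +
  fixes X :: "'w \<Rightarrow> 'h::{real_inner, banach, second_countable_topology}"
    and Y :: "'w \<Rightarrow> real"
    and lam :: "nat \<Rightarrow> real" and e :: "nat \<Rightarrow> 'h" and sigma_eps :: real
  assumes infinite_dimensional: "\<not> (\<exists>B :: 'h set. finite B \<and> span B = UNIV)"
    and X_measurable: "X \<in> borel_measurable M"
    and Y_measurable: "Y \<in> borel_measurable M"
    and X_square_integrable: "integrable M (\<lambda>\<omega>. (norm (X \<omega>))\<^sup>2)"
    and Y_square_integrable: "integrable M (\<lambda>\<omega>. (Y \<omega>)\<^sup>2)"
    and X_centered: "(\<integral>\<omega>. X \<omega> \<partial>M) = 0"
    and eigen: "eigensystem (covariance_op M X) lam e"
    and lam_simple: "\<And>j. lam (Suc j) < lam j"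
    and lam_pos: "\<And>j. 0 < lam j"
    and picard: "summable (\<lambda>j. (cross_cov M X Y \<bullet> e j)\<^sup>2 / (lam j)\<^sup>2)"
    and error_mean: "AE \<omega> in M. real_cond_exp M (vimage_algebra (space M) X borel)
                        (model_error M X Y lam e) \<omega> = 0"
    and error_variance: "AE \<omega> in M. real_cond_exp M (vimage_algebra (space M) X borel)
                        (\<lambda>\<omega>. (model_error M X Y lam e \<omega>)\<^sup>2) \<omega> = sigma_eps\<^sup>2"
    and sigma_eps_pos: "0 < sigma_eps"

definition iid_copies ::
  "'w measure \<Rightarrow> ('w \<Rightarrow> 'h::{real_inner, banach, second_countable_topology}) \<Rightarrow> ('w \<Rightarrow> real) \<Rightarrow>
   (nat \<Rightarrow> 'w \<Rightarrow> 'h) \<Rightarrow> (nat \<Rightarrow> 'w \<Rightarrow> real) \<Rightarrow> bool" where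
  "iid_copies M X Y Xs Ys \<longleftrightarrow>
     prob_space.indep_vars M (\<lambda>_. borel \<Otimes>\<^sub>M borel) (\<lambda>i \<omega>. (Xs i \<omega>, Ys i \<omega>)) UNIV \<and>
     (\<forall>i. distr M (borel \<Otimes>\<^sub>M borel) (\<lambda>\<omega>. (Xs i \<omega>, Ys i \<omega>)) =
          distr M (borel \<Otimes>\<^sub>M borel) (\<lambda>\<omega>. (X \<omega>, Y \<omega>)))"

definition empirical_cov :: "(nat \<Rightarrow> 'w \<Rightarrow> 'h::real_inner) \<Rightarrow> nat \<Rightarrow> 'w \<Rightarrow> 'h \<Rightarrow> 'h" where
  "empirical_cov Xs n \<omega> h = (1 / real n) *\<^sub>R (\<Sum>i<n. (Xs i \<omega> \<bullet> h) *\<^sub>R Xs i \<omega>)"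

definition empirical_cross_cov ::
  "(nat \<Rightarrow> 'w \<Rightarrow> 'h::real_inner) \<Rightarrow> (nat \<Rightarrow> 'w \<Rightarrow> real) \<Rightarrow> nat \<Rightarrow> 'w \<Rightarrow> 'h" where
  "empirical_cross_cov Xs Ys n \<omega> = (1 / real n) *\<^sub>R (\<Sum>i<n. Ys i \<omega> *\<^sub>R Xs i \<omega>)"

definition regularized_inverse ::
  "(nat \<Rightarrow> real \<Rightarrow> real) \<Rightarrow> (nat \<Rightarrow> 'w \<Rightarrow> nat \<Rightarrow> real) \<Rightarrow> (nat \<Rightarrow> 'w \<Rightarrow> nat \<Rightarrow> 'h::real_inner) \<Rightarrow>
   nat \<Rightarrow> 'w \<Rightarrow> 'h \<Rightarrow> 'h" where
  "regularized_inverse f lhat ehat n \<omega> h =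
     (\<Sum>j<n. (f n (lhat n \<omega> j) * (ehat n \<omega> j \<bullet> h)) *\<^sub>R ehat n \<omega> j)"

definition slope_estimator ::
  "(nat \<Rightarrow> 'w \<Rightarrow> 'h::real_inner) \<Rightarrow> (nat \<Rightarrow> 'w \<Rightarrow> real) \<Rightarrow> (nat \<Rightarrow> real \<Rightarrow> real) \<Rightarrow>
   (nat \<Rightarrow> 'w \<Rightarrow> nat \<Rightarrow> real) \<Rightarrow> (nat \<Rightarrow> 'w \<Rightarrow> nat \<Rightarrow> 'h) \<Rightarrow> nat \<Rightarrow> 'w \<Rightarrow> 'h" where
  "slope_estimator Xs Ys f lhat ehat n \<omega> =
     regularized_inverse f lhat ehat n \<omega> (empirical_cross_cov Xs Ys n \<omega>)"

definition eigengap :: "(nat \<Rightarrow> real) \<Rightarrow> nat \<Rightarrow> real" where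
  "eigengap lam j =
     (if j = 0 then lam 0 - lam 1 else min (lam j - lam (Suc j)) (lam (j - 1) - lam j))"

text \<open>
  Monotonicity is meant in the weak sense. \<open>f n\<close> vanishes to the left of \<open>c n\<close>, so its derivative
  at the endpoint \<open>c n\<close> is one-sided. The supremum of an unbounded set of reals is unspecified in
  HOL, hence the explicit boundedness of the deviations for large \<open>n\<close>, which is part of saying that
  their supremum tends to 0.
\<close>
locale regularization_scheme =
  fixes lam c :: "nat \<Rightarrow> real" and f :: "nat \<Rightarrow> real \<Rightarrow> real"
  assumes c_pos: "\<And>n. 0 < c n"
    and c_limit: "c \<longlonglongrightarrow> 0"
    and c_less: "\<And>n. c n < lam 0"
    and f_nonneg: "\<And>n x. 0 \<le> f n x"
    and f_support: "\<And>n. closure {x. f n x \<noteq> 0} = {c n..}"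
    and f_decreasing: "\<And>n. antimono_on {c n..lam 0 + eigengap lam 0} (f n)"
    and f_deviation_bounded:
      "eventually (\<lambda>n. bdd_above ((\<lambda>x. \<bar>x * f n x - 1\<bar>) ` {c n..})) sequentially"
    and f_deviation_limit: "(\<lambda>n. SUP x\<in>{c n..}. \<bar>x * f n x - 1\<bar>) \<longlonglongrightarrow> 0"
    and f_differentiable: "\<And>n. f n differentiable_on {c n..}"

text \<open>Weak convergence of random elements, tested against bounded norm-continuous functions; the
  limit may live on a different probability space.\<close>
definition converges_in_distribution ::
  "'w measure \<Rightarrow> (nat \<Rightarrow> 'w \<Rightarrow> 'h::real_normed_vector) \<Rightarrow> 'v measure \<Rightarrow> ('v \<Rightarrow> 'h) \<Rightarrow> bool" where
  "converges_in_distribution M U N Z \<longleftrightarrow>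
     (\<forall>n. U n \<in> borel_measurable M) \<and> Z \<in> borel_measurable N \<and>
     (\<forall>g :: 'h \<Rightarrow> real. continuous_on UNIV g \<and> bounded (range g) \<longrightarrow>
        (\<lambda>n. \<integral>\<omega>. g (U n \<omega>) \<partial>M) \<longlonglongrightarrow> (\<integral>v. g (Z v) \<partial>N))"

definition degenerate :: "'v measure \<Rightarrow> ('v \<Rightarrow> 'h) \<Rightarrow> bool" where
  "degenerate N Z \<longleftrightarrow> (\<exists>a. AE v in N. Z v = a)"

end

theory Submission
  imports Defs
begin

text \<open>Write \<open>\<Gamma>\<close> and \<open>\<Gamma>\<^sub>n\<close> for the covariance operator and its empirical version, \<open>T\<^sub>n\<close> for
  the estimation error, and \<open>U\<^sub>n\<close> for the mean of \<open>\<epsilon>\<^sub>i X\<^sub>i\<close>. The heart of the matter is that, tested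
  against vectors in the range of \<open>\<Gamma>\<^sup>2\<close>, the error is as good as an empirical mean:
  \<open>\<langle>T\<^sub>n, \<Gamma> (\<Gamma> k)\<rangle> = \<langle>U\<^sub>n, \<Gamma> k\<rangle> + remainder\<close>, and the remainder is at most
  \<open>o(1) \<parallel>T\<^sub>n\<parallel> + o(1 / sqrt n)\<close> in probability (\<open>spectral_cutoff_expansion\<close>, then
  \<open>root_n_error_expansion\<close>). To see it, replace the outer \<open>\<Gamma>\<close> by \<open>\<Gamma>\<^sub>n\<close> restricted to the
  spectral subspace of \<open>\<Gamma>\<^sub>n\<close> above the cutoff \<open>c\<^sub>n\<close>. This costs
  \<open>\<parallel>(\<Gamma> - \<Gamma>\<^sub>n) h\<parallel> + c\<^sub>n \<parallel>h\<parallel>\<close>, which tends to 0 at fixed \<open>h\<close>, and on that subspace the regularized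
  inverse really inverts \<open>\<Gamma>\<^sub>n\<close> up to \<open>o(1 / sqrt n)\<close>. As \<open>\<Gamma>\<^sub>n\<close> and \<open>\<Gamma>\<close> are
  compared on fixed vectors only, everything random reduces to means of independent Hilbert space
  valued variables, which are of order \<open>1 / sqrt n\<close> (\<open>bounded_in_prob_root_n_mean\<close>).

  Suppose now that \<open>\<alpha>\<^sub>n T\<^sub>n\<close> converges in distribution to \<open>Z\<close>. Its norms are then bounded in
  probability, which makes the expansion usable and has two consequences.

  The normalization is slower than root \<open>n\<close> (\<open>normalization_slower_than_root_n\<close>). Otherwise
  \<open>sqrt n T\<^sub>n\<close> would stay in a fixed ball with probability at least \<open>3/4\<close> for infinitely many \<open>n\<close>.
  By the expansion with \<open>k = e\<^sub>p\<close> and the one-dimensional central limit theorem, however, the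
  coordinate of \<open>sqrt n T\<^sub>n\<close> along \<open>e\<^sub>p\<close> is close to a centred normal variable with variance
  \<open>\<sigma>\<^sup>2 / \<lambda>\<^sub>p\<close>. As \<open>\<lambda>\<^sub>p\<close> tends to 0, such a variable leaves any fixed ball with
  probability close to 1.

  The limit vanishes (\<open>limit_zero_if_slower_than_root_n\<close>). If \<open>\<alpha>\<^sub>n / sqrt n\<close> tends to 0, the
  expansion shows that \<open>\<langle>\<alpha>\<^sub>n T\<^sub>n, \<Gamma> (\<Gamma> k)\<rangle>\<close> tends to 0 in probability, so
  \<open>\<langle>Z, \<Gamma> (\<Gamma> k)\<rangle> = 0\<close> almost surely. Letting \<open>k\<close> run through a countable dense set gives
  \<open>\<Gamma> (\<Gamma> Z) = 0\<close>, hence \<open>Z = 0\<close> by injectivity of \<open>\<Gamma>\<close>.\<close>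

section \<open>Finite parts of an orthonormal sequence\<close>

lemma orthonormal_inner_sum:
  fixes v :: "nat \<Rightarrow> 'h::real_inner"
  assumes orth: "\<And>i j. v i \<bullet> v j = (if i = j then 1 else 0)"
    and fin: "finite A"
  shows "v k \<bullet> (\<Sum>i\<in>A. a i *\<^sub>R v i) = (if k \<in> A then a k else 0)"
proof -
  have "v k \<bullet> (\<Sum>i\<in>A. a i *\<^sub>R v i) = (\<Sum>i\<in>A. if k = i then a i else 0)"
    by (auto simp: inner_sum_right orth intro!: sum.cong)
  also have "\<dots> = (if k \<in> A then a k else 0)"
    using fin by (simp add: sum.delta')
  finally show ?thesis .
qed

lemma orthonormal_norm_sum:
  fixes v :: "nat \<Rightarrow> 'h::real_inner"
  assumes orth: "\<And>i j. v i \<bullet> v j = (if i = j then 1 else 0)"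
    and fin: "finite A"
  shows "(norm (\<Sum>i\<in>A. a i *\<^sub>R v i))\<^sup>2 = (\<Sum>i\<in>A. (a i)\<^sup>2)"
  unfolding power2_norm_eq_inner
  by (simp add: inner_sum_left[of _ A] orthonormal_inner_sum[of v, OF orth fin] power2_eq_square
      cong: sum.cong)

lemma bessel_inequality:
  fixes v :: "nat \<Rightarrow> 'h::real_inner"
  assumes orth: "\<And>i j. v i \<bullet> v j = (if i = j then 1 else 0)"
    and fin: "finite A"
  shows "(\<Sum>i\<in>A. (v i \<bullet> x)\<^sup>2) \<le> (norm x)\<^sup>2"
proof -
  define P where "P = (\<Sum>i\<in>A. (v i \<bullet> x) *\<^sub>R v i)"
  have PP: "P \<bullet> P = (\<Sum>i\<in>A. (v i \<bullet> x)\<^sup>2)"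
    unfolding P_def power2_norm_eq_inner[symmetric] by (rule orthonormal_norm_sum[OF orth fin])
  have Px: "P \<bullet> x = (\<Sum>i\<in>A. (v i \<bullet> x)\<^sup>2)"
    unfolding P_def by (simp add: inner_sum_left power2_eq_square)
  have "0 \<le> (x - P) \<bullet> (x - P)" by simp
  also have "\<dots> = x \<bullet> x - (\<Sum>i\<in>A. (v i \<bullet> x)\<^sup>2)"
    by (simp add: inner_diff_left inner_diff_right PP Px inner_commute[of x P])
  finally show ?thesis by (simp add: power2_norm_eq_inner)
qed

lemma norm_orthonormal_multiplier:
  fixes v :: "nat \<Rightarrow> 'h::real_inner"
  assumes orth: "\<And>i j. v i \<bullet> v j = (if i = j then 1 else 0)"
    and fin: "finite A" and b: "0 \<le> b" "\<And>i. i \<in> A \<Longrightarrow> \<bar>a i\<bar> \<le> b"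
  shows "norm (\<Sum>i\<in>A. (a i * (v i \<bullet> x)) *\<^sub>R v i) \<le> b * norm x"
proof -
  have "(norm (\<Sum>i\<in>A. (a i * (v i \<bullet> x)) *\<^sub>R v i))\<^sup>2 = (\<Sum>i\<in>A. (a i)\<^sup>2 * (v i \<bullet> x)\<^sup>2)"
    by (simp add: orthonormal_norm_sum[OF orth fin] power_mult_distrib)
  also have "\<dots> \<le> (\<Sum>i\<in>A. b\<^sup>2 * (v i \<bullet> x)\<^sup>2)"
    using b by (intro sum_mono mult_right_mono) (auto simp: abs_le_square_iff[symmetric])
  also have "\<dots> = b\<^sup>2 * (\<Sum>i\<in>A. (v i \<bullet> x)\<^sup>2)"
    by (simp add: sum_distrib_left)
  also have "\<dots> \<le> b\<^sup>2 * (norm x)\<^sup>2"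
    by (intro mult_left_mono bessel_inequality[OF orth fin]) auto
  finally show ?thesis
    using b by (metis mult_nonneg_nonneg norm_ge_zero power2_le_imp_le power_mult_distrib)
qed

lemma abs_orthonormal_multiplier_form:
  fixes v :: "nat \<Rightarrow> 'h::real_inner"
  assumes orth: "\<And>i j. v i \<bullet> v j = (if i = j then 1 else 0)"
    and fin: "finite A" and b: "0 \<le> b" "\<And>i. i \<in> A \<Longrightarrow> \<bar>a i\<bar> \<le> b"
  shows "\<bar>\<Sum>i\<in>A. a i * (v i \<bullet> x) * (v i \<bullet> y)\<bar> \<le> b * norm x * norm y"
proof -
  have "(\<Sum>i\<in>A. a i * (v i \<bullet> x) * (v i \<bullet> y)) = (\<Sum>i\<in>A. (a i * (v i \<bullet> x)) *\<^sub>R v i) \<bullet> y"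
    by (simp add: inner_sum_left)
  also have "\<bar>\<dots>\<bar> \<le> norm (\<Sum>i\<in>A. (a i * (v i \<bullet> x)) *\<^sub>R v i) * norm y"
    by (rule Cauchy_Schwarz_ineq2)
  also have "\<dots> \<le> b * norm x * norm y"
    by (intro mult_right_mono norm_orthonormal_multiplier[OF orth fin b]) auto
  finally show ?thesis .
qed

section \<open>Spectral decomposition of the empirical covariance operator\<close>

text \<open>The usual discriminant argument. It has to cover forms that vanish on nonzero vectors, where
  Cauchy-Schwarz for inner products does not apply.\<close>
lemma psd_form_Cauchy_Schwarz:
  fixes S :: "'h::real_inner \<Rightarrow> 'h"
  assumes lin: "linear S" and sym: "\<And>x y. S x \<bullet> y = x \<bullet> S y" and psd: "\<And>x. 0 \<le> S x \<bullet> x"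
  shows "(S x \<bullet> y)\<^sup>2 \<le> (S x \<bullet> x) * (S y \<bullet> y)"
proof -
  define a b c where "a = S x \<bullet> x" and "b = S x \<bullet> y" and "c = S y \<bullet> y"
  have quad: "0 \<le> a + 2 * b * t + c * t\<^sup>2" for t
  proof -
    have "S y \<bullet> x = b"
      unfolding b_def by (metis sym inner_commute)
    then have "S (x + t *\<^sub>R y) \<bullet> (x + t *\<^sub>R y) = a + 2 * b * t + c * t\<^sup>2"
      by (simp add: linear_add[OF lin] linear_scale[OF lin] inner_add_left inner_add_right
          a_def[symmetric] b_def[symmetric] c_def[symmetric] power2_eq_square algebra_simps)
    then show ?thesis using psd[of "x + t *\<^sub>R y"] by simp
  qed
  have "b\<^sup>2 \<le> a * c"
  proof (cases "c = 0")
    case True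
    have "b = 0"
    proof (rule ccontr)
      assume "b \<noteq> 0"
      \<comment> \<open>at this point the affine function \<open>a + 2 b t\<close> takes the value \<open>-1\<close>\<close>
      then show False using quad[of "- (a + 1) / (2 * b)"] True by (simp add: field_simps)
    qed
    then show ?thesis using True by simp
  next
    case False
    then have "c > 0" using psd[of y] by (simp add: c_def)
    then show ?thesis using quad[of "- b / c"]
      by (simp add: field_simps power2_eq_square)
  qed
  then show ?thesis by (simp add: a_def b_def c_def)
qed

text \<open>The Rayleigh quotient need not attain its supremum \<open>m\<close> a priori, but
  \<open>\<parallel>S x - m x\<parallel>\<^sup>2 \<le> m\<^sup>2 - m \<langle>S x, x\<rangle>\<close> on the unit ball, so along a maximizing sequence \<open>x\<close> is close to
  \<open>S x / m\<close>, and compactness gives a limit.\<close>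
lemma psd_compact_has_eigenvector:
  fixes S :: "'h::real_inner \<Rightarrow> 'h"
  assumes bl: "bounded_linear S"
    and sym: "\<And>x y. S x \<bullet> y = x \<bullet> S y" and psd: "\<And>x. 0 \<le> S x \<bullet> x"
    and K: "compact K" "\<And>x. norm x \<le> 1 \<Longrightarrow> S x \<in> K"
    and nz: "S x0 \<noteq> 0"
  obtains m z where "m > 0" "z \<noteq> 0" "S z = m *\<^sub>R z"
proof -
  interpret S: bounded_linear S by fact
  have lin: "linear S" by (rule S.linear_axioms)
  note CS = psd_form_Cauchy_Schwarz[OF lin sym psd]
  define q where "q x = S x \<bullet> x" for x
  define m where "m = (SUP x\<in>cball 0 1. q x)"
  have bdd: "bdd_above (q ` cball 0 1)"
  proof (rule bdd_aboveI2)
    fix x :: 'h assume "x \<in> cball 0 1"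
    then have x: "norm x \<le> 1" by simp
    have "q x \<le> norm (S x) * norm x" unfolding q_def by (rule norm_cauchy_schwarz)
    also have "\<dots> \<le> (onorm S * norm x) * norm x"
      by (intro mult_right_mono onorm bl) auto
    also have "\<dots> \<le> (onorm S * 1) * 1"
      using x by (intro mult_mono mult_nonneg_nonneg) (auto intro: onorm_pos_le bl)
    finally show "q x \<le> onorm S" by simp
  qed
  have q_le: "q x \<le> m" if "norm x \<le> 1" for x
    unfolding m_def by (rule cSUP_upper[OF _ bdd]) (use that in auto)
  have q_le': "q x \<le> m * (norm x)\<^sup>2" for x
  proof (cases "x = 0")
    case False
    have "q ((1 / norm x) *\<^sub>R x) \<le> m" using False by (intro q_le) auto
    then show ?thesis using False
      by (simp add: q_def S.scaleR field_simps power2_eq_square)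
  qed (simp add: q_def)
  have m_pos: "m > 0"
  proof (rule ccontr)
    assume "\<not> m > 0"
    then have "q (S x0) \<le> 0"
      using q_le'[of "S x0"] by (meson mult_nonpos_nonneg not_less order_trans zero_le_power2)
    then have "q (S x0) = 0" using psd by (simp add: q_def antisym)
    then have "(S x0 \<bullet> S x0)\<^sup>2 \<le> 0" using CS[of x0 "S x0"] by (simp add: q_def)
    then show False using nz by simp
  qed
  have near: "(norm (S x - m *\<^sub>R x))\<^sup>2 \<le> m * (m - q x)" if "norm x \<le> 1" for x
  proof -
    have "(S x \<bullet> S x)\<^sup>2 \<le> q x * q (S x)" using CS[of x "S x"] by (simp add: q_def)
    also have "\<dots> \<le> q x * (m * (norm (S x))\<^sup>2)"
      by (intro mult_left_mono q_le') (simp add: q_def psd)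
    finally have "(S x \<bullet> S x) * (S x \<bullet> S x) \<le> (m * q x) * (S x \<bullet> S x)"
      unfolding power2_norm_eq_inner by (simp add: power2_eq_square mult_ac)
    then have 1: "S x \<bullet> S x \<le> m * q x"
      using m_pos psd[of x] inner_ge_zero[of "S x"]
      by (cases "S x \<bullet> S x = 0") (auto simp: q_def mult_le_cancel_right)
    have "x \<bullet> x \<le> 1" using that by (simp add: norm_eq_sqrt_inner)
    then have "m\<^sup>2 * (x \<bullet> x) \<le> m\<^sup>2" by (simp add: mult_left_le)
    moreover have "(norm (S x - m *\<^sub>R x))\<^sup>2 = S x \<bullet> S x - 2 * m * q x + m\<^sup>2 * (x \<bullet> x)"
      unfolding power2_norm_eq_inner
      by (simp add: inner_diff_left inner_diff_right q_def
          inner_commute[of x "S x"] power2_eq_square algebra_simps)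
    ultimately show ?thesis using 1 by (simp add: power2_eq_square algebra_simps)
  qed
  have "\<exists>x. norm x \<le> 1 \<and> m - 1 / Suc k < q x" for k
  proof -
    have "m - 1 / Suc k < (SUP x\<in>cball 0 1. q x)" by (simp add: m_def[symmetric])
    then obtain x where "x \<in> cball 0 1" "m - 1 / Suc k < q x"
      using less_cSUP_iff[OF _ bdd, of "m - 1 / Suc k"] by auto
    then show ?thesis by auto
  qed
  then obtain x where x: "\<And>k. norm (x k) \<le> 1" "\<And>k. m - 1 / Suc k < q (x k)"
    by metis
  have qx: "(\<lambda>k. q (x k)) \<longlonglongrightarrow> m"
  proof (rule tendsto_sandwich[where f = "\<lambda>k. m - 1 / Suc k" and h = "\<lambda>_. m"])
    show "(\<lambda>k. m - 1 / real (Suc k)) \<longlonglongrightarrow> m"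
      using tendsto_diff[OF tendsto_const[of m] LIMSEQ_inverse_real_of_nat]
      by (simp add: inverse_eq_divide)
  qed (use x q_le in \<open>auto intro!: eventuallyI less_imp_le\<close>)
  have "(\<lambda>k. (norm (S (x k) - m *\<^sub>R x k))\<^sup>2) \<longlonglongrightarrow> 0"
  proof (rule tendsto_sandwich[where f = "\<lambda>_. 0" and h = "\<lambda>k. m * (m - q (x k))"])
    show "(\<lambda>k. m * (m - q (x k))) \<longlonglongrightarrow> 0"
      using tendsto_mult[OF tendsto_const[of m] tendsto_diff[OF tendsto_const[of m] qx]] by simp
  qed (use near x in \<open>auto intro!: eventuallyI\<close>)
  then have "(\<lambda>k. norm (S (x k) - m *\<^sub>R x k)) \<longlonglongrightarrow> 0"
    using tendsto_real_sqrt by fastforce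
  then have near0: "(\<lambda>k. S (x k) - m *\<^sub>R x k) \<longlonglongrightarrow> 0"
    by (rule tendsto_norm_zero_cancel)
  have "seq_compact K" using K(1) by (simp add: compact_imp_seq_compact)
  then obtain y r where r: "strict_mono r" "((\<lambda>k. S (x k)) \<circ> r) \<longlonglongrightarrow> y"
    using seq_compactE[of K "\<lambda>k. S (x k)"] K(2)[OF x(1)] by metis
  have "(\<lambda>k. (1 / m) *\<^sub>R (S (x (r k)) - (S (x (r k)) - m *\<^sub>R x (r k)))) \<longlonglongrightarrow> (1 / m) *\<^sub>R (y - 0)"
    using r near0 by (intro tendsto_intros) (auto simp: o_def dest: LIMSEQ_subseq_LIMSEQ)
  then have xz: "(\<lambda>k. x (r k)) \<longlonglongrightarrow> (1 / m) *\<^sub>R y"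
    using m_pos by simp
  then have "(\<lambda>k. S (x (r k))) \<longlonglongrightarrow> S ((1 / m) *\<^sub>R y)"
    by (rule S.tendsto)
  with r(2) have Sy: "S ((1 / m) *\<^sub>R y) = y"
    by (auto simp: o_def intro: LIMSEQ_unique)
  have "(\<lambda>k. q (x (r k))) \<longlonglongrightarrow> q ((1 / m) *\<^sub>R y)"
    unfolding q_def by (intro tendsto_intros xz S.tendsto)
  moreover have "(\<lambda>k. q (x (r k))) \<longlonglongrightarrow> m"
    using LIMSEQ_subseq_LIMSEQ[OF qx r(1)] by (simp add: o_def)
  ultimately have "q ((1 / m) *\<^sub>R y) = m" by (rule LIMSEQ_unique)
  then have "(1 / m) *\<^sub>R y \<noteq> 0" using m_pos by (auto simp: q_def)
  moreover have "S ((1 / m) *\<^sub>R y) = m *\<^sub>R ((1 / m) *\<^sub>R y)" using Sy m_pos by simp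
  ultimately show ?thesis using m_pos that by blast
qed

text \<open>Puts the image of the unit ball under a finite rank operator inside a compact set. Bounded
  coefficients suffice, so the spanning vectors may be linearly dependent.\<close>
lemma compact_bounded_combinations:
  fixes x :: "nat \<Rightarrow> 'h::real_normed_vector"
  shows "compact {\<Sum>i<n. a i *\<^sub>R x i | a. \<forall>i<n. \<bar>a i\<bar> \<le> B i}"
proof (induction n)
  case (Suc n)
  have "{\<Sum>i<Suc n. a i *\<^sub>R x i | a. \<forall>i<Suc n. \<bar>a i\<bar> \<le> B i} =
      {u + w | u w. u \<in> {\<Sum>i<n. a i *\<^sub>R x i | a. \<forall>i<n. \<bar>a i\<bar> \<le> B i}
        \<and> w \<in> (\<lambda>t. t *\<^sub>R x n) ` {- B n..B n}}" (is "?L = ?R")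
  proof (rule set_eqI, rule iffI)
    fix y assume "y \<in> ?L"
    then obtain a where a: "y = (\<Sum>i<Suc n. a i *\<^sub>R x i)" "\<forall>i<Suc n. \<bar>a i\<bar> \<le> B i" by auto
    have "a n \<in> {- B n..B n}" using a(2)[rule_format, of n] by auto
    moreover have "(\<Sum>i<n. a i *\<^sub>R x i) \<in> {\<Sum>i<n. a i *\<^sub>R x i | a. \<forall>i<n. \<bar>a i\<bar> \<le> B i}"
      using a(2) by auto
    ultimately show "y \<in> ?R" using a(1) by force
  next
    fix y assume "y \<in> ?R"
    then obtain a t where a: "y = (\<Sum>i<n. a i *\<^sub>R x i) + t *\<^sub>R x n" "\<forall>i<n. \<bar>a i\<bar> \<le> B i"
      "\<bar>t\<bar> \<le> B n" by (auto simp: abs_le_iff)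
    have "y = (\<Sum>i<Suc n. (a(n := t)) i *\<^sub>R x i) \<and> (\<forall>i<Suc n. \<bar>(a(n := t)) i\<bar> \<le> B i)"
      using a by (auto simp: less_Suc_eq)
    then show "y \<in> ?L" by blast
  qed
  moreover have "compact ((\<lambda>t. t *\<^sub>R x n) ` {- B n..B n})"
    by (intro compact_continuous_image continuous_intros compact_Icc)
  ultimately show ?case using compact_sums[OF Suc.IH] by simp
qed simp

lemma inner_empirical_cov:
  "empirical_cov Xs n \<omega> h \<bullet> k = (1 / real n) * (\<Sum>i<n. (Xs i \<omega> \<bullet> h) * (Xs i \<omega> \<bullet> k))"
  by (simp add: empirical_cov_def inner_sum_left)

lemma empirical_cov_symmetric:
  "empirical_cov Xs n \<omega> h \<bullet> k = h \<bullet> empirical_cov Xs n \<omega> k"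
  by (subst (2) inner_commute) (simp add: inner_empirical_cov mult.commute)

lemma bounded_linear_empirical_cov: "bounded_linear (empirical_cov Xs n \<omega>)"
  unfolding empirical_cov_def
  by (intro bounded_linear_intros bounded_linear_sum bounded_linear_scaleR_right
      bounded_linear_compose[OF bounded_linear_scaleR_left bounded_linear_inner_right]
      bounded_linear_compose[OF bounded_linear_scaleR_right])

lemma empirical_eigenvalue_nonneg:
  assumes es: "eigensystem (empirical_cov Xs n \<omega>) l v"
  shows "0 \<le> l j"
proof -
  have "l j = empirical_cov Xs n \<omega> (v j) \<bullet> v j"
    using es by (auto simp: eigensystem_def)
  also have "\<dots> \<ge> 0"
    unfolding inner_empirical_cov by (rule mult_nonneg_nonneg) (auto intro!: sum_nonneg)
  finally show ?thesis .
qed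

text \<open>The range is spanned by the \<open>n\<close> observations, and it contains every eigenvector whose
  eigenvalue is not 0.\<close>
lemma empirical_eigenvalue_beyond_sample_size:
  assumes es: "eigensystem (empirical_cov Xs n \<omega>) l v" and j: "n \<le> j"
  shows "l j = 0"
proof (rule ccontr)
  assume nz: "l j \<noteq> 0"
  note orth = es[unfolded eigensystem_def, THEN conjunct1, rule_format]
  have pos: "0 < l i" if "i \<le> n" for i
  proof -
    have "l j \<le> l i" using es that j by (auto simp: eigensystem_def decseq_def)
    then show ?thesis using nz empirical_eigenvalue_nonneg[OF es, of j] by linarith
  qed
  have "independent (v ` {..n})"
  proof (rule pairwise_orthogonal_independent)
    show "pairwise orthogonal (v ` {..n})"
      by (auto simp: pairwise_def orthogonal_def orth)
    show "0 \<notin> v ` {..n}" using orth by (metis imageE inner_zero_left zero_neq_one)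
  qed
  moreover have "v ` {..n} \<subseteq> span ((\<lambda>i. Xs i \<omega>) ` {..<n})"
  proof clarify
    fix i assume "i \<le> n"
    then have "v i = (1 / l i) *\<^sub>R empirical_cov Xs n \<omega> (v i)"
      using es pos[of i] by (auto simp: eigensystem_def)
    also have "\<dots> \<in> span ((\<lambda>i. Xs i \<omega>) ` {..<n})"
      unfolding empirical_cov_def by (intro span_scale span_sum span_base) auto
    finally show "v i \<in> span ((\<lambda>i. Xs i \<omega>) ` {..<n})" .
  qed
  ultimately have "card (v ` {..n}) \<le> card ((\<lambda>i. Xs i \<omega>) ` {..<n})"
    using independent_span_bound by blast
  also have "\<dots> \<le> n" using card_image_le[of "{..<n}"] by auto
  finally have "card (v ` {..n}) \<le> n" .
  moreover have "inj_on v {..n}"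
    by (rule inj_onI) (metis orth zero_neq_one)
  ultimately show False by (simp add: card_image)
qed

text \<open>If the remainder after the first \<open>n\<close> spectral components were not 0, it would have an
  eigenvector with a positive eigenvalue, orthogonal to the listed ones. The completeness clause of
  \<open>eigensystem\<close> excludes this.\<close>
lemma empirical_cov_spectral_decomposition:
  assumes es: "eigensystem (empirical_cov Xs n \<omega>) l v"
  shows "empirical_cov Xs n \<omega> h = (\<Sum>j<n. (l j * (v j \<bullet> h)) *\<^sub>R v j)"
proof -
  note orth = es[unfolded eigensystem_def, THEN conjunct1, rule_format]
  define T where "T = empirical_cov Xs n \<omega>"
  interpret T: bounded_linear T unfolding T_def by (rule bounded_linear_empirical_cov)
  have Tv: "T (v j) = l j *\<^sub>R v j" for j using es by (auto simp: eigensystem_def T_def)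
  define P where "P x = (\<Sum>j<n. (v j \<bullet> x) *\<^sub>R v j)" for x
  define S where "S x = T (x - P x)" for x
  have TP: "T (P x) = (\<Sum>j<n. (l j * (v j \<bullet> x)) *\<^sub>R v j)" for x
    by (simp add: P_def T.sum T.scaleR Tv mult.commute)
  have vP: "v j \<bullet> P x = (if j < n then v j \<bullet> x else 0)" for j x
    unfolding P_def by (simp add: orthonormal_inner_sum[of v, OF orth])
  have vS: "v j \<bullet> S x = 0" if "j < n" for j x
    using that by (simp add: S_def T_def empirical_cov_symmetric[symmetric]
        Tv[unfolded T_def] inner_diff_right vP)
  have PS: "P y \<bullet> S x = 0" for x y
    by (simp add: P_def inner_sum_left vS)
  have form: "S x \<bullet> y = T (x - P x) \<bullet> (y - P y)" for x y
    using PS[of y x] by (simp add: inner_diff_right inner_commute[of "S x"] S_def[symmetric])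
  have Pbl: "bounded_linear P"
    unfolding P_def
    by (intro bounded_linear_sum bounded_linear_compose[OF bounded_linear_scaleR_left
          bounded_linear_inner_right])
  have Sbl: "bounded_linear S"
    unfolding S_def
    by (intro bounded_linear_compose[OF T.bounded_linear_axioms] bounded_linear_sub
        bounded_linear_ident Pbl)
  have S0: "S x = 0" for x
  proof (rule ccontr)
    assume nz: "S x \<noteq> 0"
    have PB: "norm (P x) \<le> norm x" for x
      using norm_orthonormal_multiplier[of v "{..<n}" 1 "\<lambda>_. 1" x, OF orth] by (simp add: P_def)
    define K where "K = {\<Sum>i<n. a i *\<^sub>R Xs i \<omega> | a. \<forall>i<n. \<bar>a i\<bar> \<le> 2 * norm (Xs i \<omega>) / n}"
    have SK: "S x \<in> K" if "norm x \<le> 1" for x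
    proof -
      have nx: "norm (x - P x) \<le> 2"
        using norm_triangle_ineq4[of x "P x"] PB[of x] that by linarith
      have eq: "S x = (\<Sum>i<n. ((Xs i \<omega> \<bullet> (x - P x)) / n) *\<^sub>R Xs i \<omega>)"
        by (simp add: S_def T_def empirical_cov_def scaleR_sum_right)
      have le: "\<bar>(Xs i \<omega> \<bullet> (x - P x)) / n\<bar> \<le> 2 * norm (Xs i \<omega>) / n" for i
      proof -
        have "\<bar>Xs i \<omega> \<bullet> (x - P x)\<bar> \<le> norm (Xs i \<omega>) * norm (x - P x)"
          by (rule Cauchy_Schwarz_ineq2)
        also have "\<dots> \<le> norm (Xs i \<omega>) * 2" by (intro mult_left_mono nx) auto
        finally show ?thesis by (simp add: divide_right_mono)
      qed
      show ?thesis
        unfolding K_def mem_Collect_eq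
        by (rule exI[of _ "\<lambda>i. (Xs i \<omega> \<bullet> (x - P x)) / n"]) (use eq le in blast)
    qed
    have sym: "S x \<bullet> y = x \<bullet> S y" for x y
    proof -
      have "S x \<bullet> y = (x - P x) \<bullet> T (y - P y)"
        unfolding form T_def by (rule empirical_cov_symmetric)
      also have "\<dots> = x \<bullet> S y" by (metis form inner_commute)
      finally show ?thesis .
    qed
    have psd: "0 \<le> S x \<bullet> x" for x
      unfolding form unfolding T_def inner_empirical_cov
      by (rule mult_nonneg_nonneg) (auto intro!: sum_nonneg)
    have "compact K" unfolding K_def by (rule compact_bounded_combinations)
    from psd_compact_has_eigenvector[of S, OF Sbl sym psd this SK nz]
    obtain m z where mz: "m > 0" "z \<noteq> 0" "S z = m *\<^sub>R z" by metis
    have vz: "v j \<bullet> z = 0" if "j < n" for j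
      using vS[OF that, of z] mz by simp
    then have "P z = 0" by (simp add: P_def)
    then have "T z = m *\<^sub>R z" using mz(3) by (simp add: S_def)
    then have "z \<in> span (v ` {j. l j = m})"
      using es mz(1) by (auto simp: eigensystem_def T_def)
    moreover have "v ` {j. l j = m} \<subseteq> {y. orthogonal z y}"
    proof clarify
      fix j assume "m = l j"
      then have "j < n" using empirical_eigenvalue_beyond_sample_size[OF es, of j] mz(1)
        by (metis less_irrefl not_less)
      then show "orthogonal z (v j)" using vz by (simp add: orthogonal_def inner_commute)
    qed
    ultimately have "z \<in> {y. orthogonal z y}"
      using span_minimal[OF _ subspace_orthogonal_to_vector] by blast
    then show False using mz(2) by (simp add: orthogonal_def)
  qed
  have "T h = S h + T (P h)" by (simp add: S_def T.diff)
  also have "\<dots> = (\<Sum>j<n. (l j * (v j \<bullet> h)) *\<^sub>R v j)" by (simp only: S0 TP add_0_left)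
  finally show ?thesis by (simp only: T_def)
qed

section \<open>Expansion of the estimation error\<close>

text \<open>Here \<open>G\<close> is the empirical operator with spectral pairs \<open>(l j, v j)\<close>, \<open>D\<close> its regularized
  inverse with cutoff \<open>c\<close>, and \<open>L\<close> the operator that \<open>G\<close> approximates. The proof splits
  \<open>L h = (L h - G h) + (G h - G (P h)) + G (P h)\<close> with \<open>P\<close> the projection onto the components above
  the cutoff. The first two parts are small in norm and meet \<open>T\<close> through Cauchy-Schwarz. On the
  third the factor \<open>l j\<close> in \<open>G\<close> compensates \<open>g (l j)\<close> in \<open>D\<close>, so that large values of \<open>g\<close>
  do no harm. What remains is \<open>U \<bullet> P h\<close>, and \<open>h - P h\<close> is small because \<open>h\<close> lies in the range
  of \<open>L\<close>: the components of \<open>G k\<close> below the cutoff have norm at most \<open>c * norm k\<close>.\<close>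
lemma spectral_cutoff_expansion:
  fixes v :: "nat \<Rightarrow> 'h::real_inner" and G L :: "'h \<Rightarrow> 'h"
  assumes orth: "\<And>i j. v i \<bullet> v j = (if i = j then 1 else 0)"
    and G: "\<And>x. G x = (\<Sum>j<n. (l j * (v j \<bullet> x)) *\<^sub>R v j)"
    and D: "\<And>x. D x = (\<Sum>j<n. (g (l j) * (v j \<bullet> x)) *\<^sub>R v j)"
    and l_nonneg: "\<And>j. 0 \<le> l j"
    and g_below: "\<And>s. s < c \<Longrightarrow> g s = 0"
    and g_above: "\<And>s. c \<le> s \<Longrightarrow> \<bar>s * g s - 1\<bar> \<le> \<eta>"
    and c: "0 \<le> c"
    and h: "h = L k"
    and T: "T = D (G r + U) - r"
  shows "\<bar>T \<bullet> L h - U \<bullet> h\<bar> \<le> norm T * (norm (L h - G h) + c * norm h) + \<eta> * norm (G r) * norm h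
     + norm U * (\<eta> * norm h + norm (L k - G k) + c * norm k)"
proof -
  define J where "J = {j. j < n \<and> c \<le> l j}"
  define P where "P x = (\<Sum>j\<in>J. (v j \<bullet> x) *\<^sub>R v j)" for x
  have J[simp]: "finite J" "J \<subseteq> {..<n}" by (auto simp: J_def)
  have eta: "0 \<le> \<eta>" using g_above[of c] by auto
  have split: "(\<Sum>j<n. a j) = (\<Sum>j\<in>J. a j) + (\<Sum>j\<in>{..<n} - J. a j)" for a :: "nat \<Rightarrow> 'h"
    by (metis J(2) add.commute finite_lessThan sum.subset_diff)
  have vG: "v j \<bullet> G x = l j * (v j \<bullet> x)" if "j \<in> J" for j x
    using that by (simp add: G orthonormal_inner_sum[of v, OF orth] J_def)
  have vD: "v j \<bullet> D x = g (l j) * (v j \<bullet> x)" if "j \<in> J" for j x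
    using that by (simp add: D orthonormal_inner_sum[of v, OF orth] J_def)
  have vP: "v j \<bullet> P x = (if j \<in> J then v j \<bullet> x else 0)" for j x
    unfolding P_def by (rule orthonormal_inner_sum[OF orth J(1)])
  have GP: "G (P x) = (\<Sum>j\<in>J. (l j * (v j \<bullet> x)) *\<^sub>R v j)" for x
    unfolding G split vP by simp
  have PG: "P (G x) = (\<Sum>j\<in>J. (l j * (v j \<bullet> x)) *\<^sub>R v j)" for x
    unfolding P_def by (intro sum.cong) (auto simp: vG)
  have tail: "norm (\<Sum>j\<in>{..<n} - J. (l j * (v j \<bullet> x)) *\<^sub>R v j) \<le> c * norm x" for x
    by (intro norm_orthonormal_multiplier[of v, OF orth]) (use c l_nonneg in \<open>auto simp: J_def\<close>)
  have G_GP: "norm (G x - G (P x)) \<le> c * norm x" for x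
    unfolding GP using tail[of x] by (simp add: G split)
  have G_PG: "norm (G x - P (G x)) \<le> c * norm x" for x
    unfolding PG using tail[of x] by (simp add: G split)
  have I_P: "norm (x - P x) \<le> norm x" for x
  proof -
    have PP: "P x \<bullet> P x = P x \<bullet> x"
      unfolding P_def[of x] inner_sum_left using vP[of _ x] by (simp add: P_def)
    have "(x - P x) \<bullet> (x - P x) = x \<bullet> x - P x \<bullet> P x"
      by (simp add: inner_diff_left inner_diff_right PP inner_commute[of x "P x"])
    also have "\<dots> \<le> x \<bullet> x" by simp
    finally show ?thesis by (simp add: norm_eq_sqrt_inner)
  qed
  have P_diff: "P (x - y) = P x - P y" for x y
    by (simp add: P_def inner_diff_right scaleR_diff_left sum_subtractf)
  have h_Ph: "norm (h - P h) \<le> norm (L k - G k) + c * norm k"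
  proof -
    have "h - P h = ((L k - G k) - P (L k - G k)) + (G k - P (G k))"
      by (simp add: P_diff h)
    also have "norm \<dots> \<le> norm (L k - G k) + c * norm k"
      by (rule norm_triangle_le) (intro add_mono I_P G_PG)
    finally show ?thesis .
  qed
  define R where "R = (\<Sum>j\<in>J. (l j * g (l j) - 1) * (v j \<bullet> G r) * (v j \<bullet> h))"
  define R' where "R' = (\<Sum>j\<in>J. (l j * g (l j) - 1) * (v j \<bullet> U) * (v j \<bullet> h))"
  have R: "\<bar>R\<bar> \<le> \<eta> * norm (G r) * norm h"
    unfolding R_def
    by (rule abs_orthonormal_multiplier_form[OF orth J(1) eta]) (auto simp: J_def g_above)
  have R': "\<bar>R'\<bar> \<le> \<eta> * norm U * norm h"
    unfolding R'_def
    by (rule abs_orthonormal_multiplier_form[OF orth J(1) eta]) (auto simp: J_def g_above)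
  have "T \<bullet> G (P h) = (\<Sum>j\<in>J. l j * (v j \<bullet> T) * (v j \<bullet> h))"
    by (simp add: GP inner_sum_right inner_commute[of T] mult_ac)
  also have "\<dots> = (\<Sum>j\<in>J. (l j * g (l j) - 1) * (v j \<bullet> G r) * (v j \<bullet> h)
        + ((l j * g (l j) - 1) * (v j \<bullet> U) * (v j \<bullet> h) + (v j \<bullet> U) * (v j \<bullet> h)))"
  proof (intro sum.cong refl)
    fix j assume j: "j \<in> J"
    have "v j \<bullet> T = g (l j) * (v j \<bullet> G r + v j \<bullet> U) - v j \<bullet> r"
      using j by (simp add: T inner_diff_right vD inner_add_right)
    then have "l j * (v j \<bullet> T) = l j * (g (l j) * (v j \<bullet> G r + v j \<bullet> U) - v j \<bullet> r)"
      by simp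
    also have "\<dots> = (l j * g (l j) - 1) * (v j \<bullet> G r) + (l j * g (l j) - 1) * (v j \<bullet> U) + v j \<bullet> U"
      by (simp add: vG[OF j] algebra_simps)
    finally show "l j * (v j \<bullet> T) * (v j \<bullet> h) = (l j * g (l j) - 1) * (v j \<bullet> G r) * (v j \<bullet> h)
        + ((l j * g (l j) - 1) * (v j \<bullet> U) * (v j \<bullet> h) + (v j \<bullet> U) * (v j \<bullet> h))"
      by (simp only:) (simp add: algebra_simps)
  qed
  also have "\<dots> = R + (R' + U \<bullet> P h)"
    by (simp add: sum.distrib R_def R'_def P_def inner_sum_right inner_commute[of U] mult_ac)
  finally have main: "T \<bullet> G (P h) = R + R' + U \<bullet> P h" by simp
  have "T \<bullet> L h - U \<bullet> h = T \<bullet> (L h - G h) + T \<bullet> (G h - G (P h)) + R + R' - U \<bullet> (h - P h)"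
    using main by (simp add: inner_diff_right)
  also have "\<bar>\<dots>\<bar> \<le> \<bar>T \<bullet> (L h - G h)\<bar> + \<bar>T \<bullet> (G h - G (P h))\<bar> + \<bar>R\<bar> + \<bar>R'\<bar> + \<bar>U \<bullet> (h - P h)\<bar>"
    by linarith
  also have "\<dots> \<le> norm T * norm (L h - G h) + norm T * (c * norm h) + \<eta> * norm (G r) * norm h
      + \<eta> * norm U * norm h + norm U * (norm (L k - G k) + c * norm k)"
    by (intro add_mono R R' Cauchy_Schwarz_ineq2
        order_trans[OF Cauchy_Schwarz_ineq2] mult_left_mono G_GP h_Ph) auto
  also have "\<dots> = norm T * (norm (L h - G h) + c * norm h) + \<eta> * norm (G r) * norm h
     + norm U * (\<eta> * norm h + norm (L k - G k) + c * norm k)"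
    by (simp add: algebra_simps)
  finally show ?thesis .
qed

section \<open>Sums of independent Hilbert space valued variables\<close>

context prob_space
begin

lemma expectation_inner_indep:
  fixes A B :: "'a \<Rightarrow> 'h::{real_inner, banach, second_countable_topology}"
  assumes ind: "indep_var borel A borel B"
    and A: "integrable M A" and B: "integrable M B"
    and AB: "integrable M (\<lambda>\<omega>. A \<omega> \<bullet> B \<omega>)"
  shows "expectation (\<lambda>\<omega>. A \<omega> \<bullet> B \<omega>) = expectation A \<bullet> expectation B"
proof -
  have [measurable]: "A \<in> borel_measurable M" "B \<in> borel_measurable M" using A B by auto
  interpret DA: prob_space "distr M borel A" by (rule prob_space_distr) simp
  interpret DB: prob_space "distr M borel B" by (rule prob_space_distr) simp
  interpret P: pair_prob_space "distr M borel A" "distr M borel B" ..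
  have joint: "distr M borel A \<Otimes>\<^sub>M distr M borel B
      = distr M (borel \<Otimes>\<^sub>M borel) (\<lambda>\<omega>. (A \<omega>, B \<omega>))"
    using ind by (simp add: indep_var_distribution_eq)
  have int: "integrable (distr M borel A \<Otimes>\<^sub>M distr M borel B) (\<lambda>(x, y). x \<bullet> y)"
    unfolding joint using AB by (subst integrable_distr_eq) auto
  have intB: "integrable (distr M borel B) (\<lambda>y. y)"
    using B by (subst integrable_distr_eq) auto
  have intA: "integrable (distr M borel A) (\<lambda>x. x)"
    using A by (subst integrable_distr_eq) auto
  have eB: "(\<integral>y. y \<partial>distr M borel B) = expectation B" by (subst integral_distr) auto
  have eA: "(\<integral>y. y \<partial>distr M borel A) = expectation A" by (subst integral_distr) auto
  have "expectation (\<lambda>\<omega>. A \<omega> \<bullet> B \<omega>)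
      = (\<integral>(x, y). x \<bullet> y \<partial>(distr M borel A \<Otimes>\<^sub>M distr M borel B))"
    unfolding joint by (subst integral_distr) auto
  also have "\<dots> = (\<integral>x. (\<integral>y. x \<bullet> y \<partial>distr M borel B) \<partial>distr M borel A)"
    using P.integral_fst'[OF int] by simp
  also have "\<dots> = (\<integral>x. x \<bullet> expectation B \<partial>distr M borel A)"
    using intB by (simp add: eB)
  also have "\<dots> = expectation A \<bullet> expectation B"
    using intA by (simp add: eA)
  finally show ?thesis .
qed

lemma integrable_inner_of_squares:
  fixes A B :: "'a \<Rightarrow> 'h::{real_inner, second_countable_topology}"
  assumes [measurable]: "A \<in> borel_measurable M" "B \<in> borel_measurable M"
    and A: "integrable M (\<lambda>\<omega>. (norm (A \<omega>))\<^sup>2)" and B: "integrable M (\<lambda>\<omega>. (norm (B \<omega>))\<^sup>2)"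
  shows "integrable M (\<lambda>\<omega>. A \<omega> \<bullet> B \<omega>)"
proof (rule Bochner_Integration.integrable_bound[OF Bochner_Integration.integrable_add[OF A B]])
  show "AE \<omega> in M. norm (A \<omega> \<bullet> B \<omega>) \<le> norm ((norm (A \<omega>))\<^sup>2 + (norm (B \<omega>))\<^sup>2)"
  proof (rule AE_I2)
    fix \<omega>
    have "\<bar>A \<omega> \<bullet> B \<omega>\<bar> \<le> norm (A \<omega>) * norm (B \<omega>)" by (rule Cauchy_Schwarz_ineq2)
    also have "\<dots> \<le> (norm (A \<omega>))\<^sup>2 + (norm (B \<omega>))\<^sup>2"
      using sum_squares_bound[of "norm (A \<omega>)" "norm (B \<omega>)"] mult_nonneg_nonneg[of "norm (A \<omega>)" "norm (B \<omega>)"]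
      by (simp del: mult_nonneg_nonneg)
    finally show "norm (A \<omega> \<bullet> B \<omega>) \<le> norm ((norm (A \<omega>))\<^sup>2 + (norm (B \<omega>))\<^sup>2)" by simp
  qed
qed simp

lemma integrable_of_square_norm:
  fixes A :: "'a \<Rightarrow> 'h::{real_inner, banach, second_countable_topology}"
  assumes [measurable]: "A \<in> borel_measurable M"
    and A: "integrable M (\<lambda>\<omega>. (norm (A \<omega>))\<^sup>2)"
  shows "integrable M A"
proof (rule Bochner_Integration.integrable_bound)
  show "integrable M (\<lambda>\<omega>. 1 + (norm (A \<omega>))\<^sup>2)" using A by simp
  have "x \<le> 1 + x\<^sup>2" for x :: real
  proof -
    have "0 \<le> (x - 1 / 2)\<^sup>2" by simp
    also have "\<dots> = x\<^sup>2 - x + 1 / 4" by (simp add: power2_eq_square algebra_simps)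
    finally show ?thesis by simp
  qed
  then show "AE \<omega> in M. norm (A \<omega>) \<le> norm (1 + (norm (A \<omega>))\<^sup>2)" by (intro AE_I2) simp
qed simp

text \<open>Independent centred variables are orthogonal in the space of square integrable functions.\<close>
lemma square_norm_sum_indep:
  fixes \<xi> :: "nat \<Rightarrow> 'a \<Rightarrow> 'h::{real_inner, banach, second_countable_topology}"
  assumes ind: "indep_vars (\<lambda>_. borel) \<xi> UNIV"
    and sq: "\<And>i. integrable M (\<lambda>\<omega>. (norm (\<xi> i \<omega>))\<^sup>2)"
    and mean: "\<And>i. expectation (\<xi> i) = 0"
    and var: "\<And>i. expectation (\<lambda>\<omega>. (norm (\<xi> i \<omega>))\<^sup>2) = s"
  shows "integrable M (\<lambda>\<omega>. (norm (\<Sum>i<n. \<xi> i \<omega>))\<^sup>2)"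
    and "expectation (\<lambda>\<omega>. (norm (\<Sum>i<n. \<xi> i \<omega>))\<^sup>2) = real n * s"
proof -
  have [measurable]: "\<xi> i \<in> borel_measurable M" for i
    using ind by (auto simp: indep_vars_def)
  have int: "integrable M (\<lambda>\<omega>. \<xi> i \<omega> \<bullet> \<xi> j \<omega>)" for i j
    by (intro integrable_inner_of_squares sq) auto
  have cov: "expectation (\<lambda>\<omega>. \<xi> i \<omega> \<bullet> \<xi> j \<omega>) = (if i = j then s else 0)" for i j
  proof (cases "i = j")
    case True
    then show ?thesis using var[of i] by (simp add: power2_norm_eq_inner)
  next
    case False
    \<comment> \<open>pairs are extracted from the family as subfamilies indexed by singletons\<close>
    have "indep_var borel ((\<lambda>f. f i) \<circ> (\<lambda>\<omega>. \<lambda>k\<in>{i}. \<xi> k \<omega>))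
        borel ((\<lambda>f. f j) \<circ> (\<lambda>\<omega>. \<lambda>k\<in>{j}. \<xi> k \<omega>))"
      by (rule indep_var_compose[OF indep_var_restrict[OF ind, of "{i}" "{j}"]])
        (use False in \<open>auto intro: measurable_component_singleton\<close>)
    then have "indep_var borel (\<xi> i) borel (\<xi> j)" by (simp add: o_def)
    then have "expectation (\<lambda>\<omega>. \<xi> i \<omega> \<bullet> \<xi> j \<omega>) = expectation (\<xi> i) \<bullet> expectation (\<xi> j)"
      by (rule expectation_inner_indep) (auto intro: integrable_of_square_norm sq int)
    then show ?thesis using False by (simp add: mean)
  qed
  have expand: "(\<lambda>\<omega>. (norm (\<Sum>i<n. \<xi> i \<omega>))\<^sup>2) = (\<lambda>\<omega>. \<Sum>i<n. \<Sum>j<n. \<xi> i \<omega> \<bullet> \<xi> j \<omega>)"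
    unfolding power2_norm_eq_inner inner_sum_left by (simp add: inner_sum_right)
  show "integrable M (\<lambda>\<omega>. (norm (\<Sum>i<n. \<xi> i \<omega>))\<^sup>2)"
    unfolding expand by (intro Bochner_Integration.integrable_sum int)
  have "expectation (\<lambda>\<omega>. (norm (\<Sum>i<n. \<xi> i \<omega>))\<^sup>2)
      = (\<Sum>i<n. \<Sum>j<n. expectation (\<lambda>\<omega>. \<xi> i \<omega> \<bullet> \<xi> j \<omega>))"
    unfolding expand by (simp add: Bochner_Integration.integral_sum int)
  also have "\<dots> = (\<Sum>i<n. s)"
    by (intro sum.cong refl) (auto simp: cov)
  finally show "expectation (\<lambda>\<omega>. (norm (\<Sum>i<n. \<xi> i \<omega>))\<^sup>2) = real n * s" by simp
qed

section \<open>Boundedness in probability\<close>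

definition bounded_in_prob :: "(nat \<Rightarrow> 'a \<Rightarrow> real) \<Rightarrow> bool" where
  "bounded_in_prob V \<longleftrightarrow>
     (\<forall>\<tau>>0. \<exists>B. \<forall>\<^sub>F n in sequentially. prob {\<omega> \<in> space M. B < V n \<omega>} \<le> \<tau>)"

lemma bounded_in_prob_add:
  assumes V: "bounded_in_prob V" and W: "bounded_in_prob W"
    and [measurable]: "\<And>n. V n \<in> borel_measurable M" "\<And>n. W n \<in> borel_measurable M"
  shows "bounded_in_prob (\<lambda>n \<omega>. V n \<omega> + W n \<omega>)"
  unfolding bounded_in_prob_def
proof (intro allI impI)
  fix \<tau> :: real assume "\<tau> > 0"
  then have "\<tau> / 2 > 0" by simp
  then obtain A B where
    A: "\<forall>\<^sub>F n in sequentially. prob {\<omega> \<in> space M. A < V n \<omega>} \<le> \<tau> / 2" and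
    B: "\<forall>\<^sub>F n in sequentially. prob {\<omega> \<in> space M. B < W n \<omega>} \<le> \<tau> / 2"
    using V W unfolding bounded_in_prob_def by meson
  from A B have "\<forall>\<^sub>F n in sequentially. prob {\<omega> \<in> space M. A + B < V n \<omega> + W n \<omega>} \<le> \<tau>"
  proof eventually_elim
    case (elim n)
    have "prob {\<omega> \<in> space M. A + B < V n \<omega> + W n \<omega>}
        \<le> prob ({\<omega> \<in> space M. A < V n \<omega>} \<union> {\<omega> \<in> space M. B < W n \<omega>})"
      by (intro finite_measure_mono) auto
    also have "\<dots> \<le> prob {\<omega> \<in> space M. A < V n \<omega>} + prob {\<omega> \<in> space M. B < W n \<omega>}"
      by (intro measure_Un_le) auto
    finally show ?case using elim by linarith
  qed
  then show "\<exists>B. \<forall>\<^sub>F n in sequentially. prob {\<omega> \<in> space M. B < V n \<omega> + W n \<omega>} \<le> \<tau>" by blast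
qed

lemma bounded_in_prob_root_n_mean:
  fixes \<xi> :: "nat \<Rightarrow> 'a \<Rightarrow> 'h::{real_inner, banach, second_countable_topology}"
  assumes ind: "indep_vars (\<lambda>_. borel) \<xi> UNIV"
    and sq: "\<And>i. integrable M (\<lambda>\<omega>. (norm (\<xi> i \<omega>))\<^sup>2)"
    and mean: "\<And>i. expectation (\<xi> i) = 0"
    and var: "\<And>i. expectation (\<lambda>\<omega>. (norm (\<xi> i \<omega>))\<^sup>2) = s"
  shows "bounded_in_prob (\<lambda>n \<omega>. sqrt n * norm ((1 / real n) *\<^sub>R (\<Sum>i<n. \<xi> i \<omega>)))"
  unfolding bounded_in_prob_def
proof (intro allI impI)
  fix \<tau> :: real assume \<tau>: "\<tau> > 0"
  have [measurable]: "\<xi> i \<in> borel_measurable M" for i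
    using ind by (auto simp: indep_vars_def)
  have s: "0 \<le> s" unfolding var[of 0, symmetric] by simp
  \<comment> \<open>the summand 1 keeps \<open>B\<close> positive when the variables vanish almost surely\<close>
  define B where "B = sqrt ((s + 1) / \<tau>)"
  have B: "B > 0" "B\<^sup>2 = (s + 1) / \<tau>" using \<tau> s by (auto simp: B_def)
  have "prob {\<omega> \<in> space M. B < sqrt n * norm ((1 / real n) *\<^sub>R (\<Sum>i<n. \<xi> i \<omega>))} \<le> \<tau>" if n: "n > 0" for n
  proof -
    let ?S = "\<lambda>\<omega>. (norm (\<Sum>i<n. \<xi> i \<omega>))\<^sup>2"
    have "prob {\<omega> \<in> space M. B < sqrt n * norm ((1 / real n) *\<^sub>R (\<Sum>i<n. \<xi> i \<omega>))}
        \<le> prob {\<omega> \<in> space M. n * B\<^sup>2 \<le> ?S \<omega>}"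
    proof (intro finite_measure_mono subsetI CollectI conjI)
      fix \<omega> assume "\<omega> \<in> {\<omega> \<in> space M. B < sqrt n * norm ((1 / real n) *\<^sub>R (\<Sum>i<n. \<xi> i \<omega>))}"
      then have \<omega>: "\<omega> \<in> space M" "B < sqrt n * norm ((1 / real n) *\<^sub>R (\<Sum>i<n. \<xi> i \<omega>))" by auto
      then show "\<omega> \<in> space M" by simp
      from \<omega> B have "B\<^sup>2 \<le> (sqrt n * norm ((1 / real n) *\<^sub>R (\<Sum>i<n. \<xi> i \<omega>)))\<^sup>2"
        by (intro power_mono) auto
      also have "\<dots> = ?S \<omega> / n"
        using n by (simp add: power_mult_distrib power_divide) (simp add: power2_eq_square)
      finally show "n * B\<^sup>2 \<le> ?S \<omega>" using n by (simp add: field_simps)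
    qed auto
    also have "\<dots> \<le> expectation ?S / (n * B\<^sup>2)"
      by (rule integral_Markov_inequality_measure[where A = "{}"])
        (use n B(1) square_norm_sum_indep(1)[OF ind sq mean var] in auto)
    also have "\<dots> = s / B\<^sup>2"
      using n B(1) by (simp add: square_norm_sum_indep(2)[OF ind sq mean var])
    also have "\<dots> \<le> \<tau>"
      using B s \<tau> by (simp add: field_simps)
    finally show ?thesis .
  qed
  then have "\<forall>\<^sub>F n in sequentially.
      prob {\<omega> \<in> space M. B < sqrt n * norm ((1 / real n) *\<^sub>R (\<Sum>i<n. \<xi> i \<omega>))} \<le> \<tau>"
    by (intro eventually_mono[OF eventually_gt_at_top[of 0]])
  then show "\<exists>B. \<forall>\<^sub>F n in sequentially.
      prob {\<omega> \<in> space M. B < sqrt n * norm ((1 / real n) *\<^sub>R (\<Sum>i<n. \<xi> i \<omega>))} \<le> \<tau>" by blast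
qed

text \<open>The law of \<open>Z\<close> gives little mass to the outside of a large ball. A continuous ramp between the
  balls of radius \<open>k\<close> and \<open>k + 1\<close> carries this over to \<open>U n\<close>.\<close>
lemma converges_in_distribution_bounded_in_prob:
  assumes conv: "converges_in_distribution M U N Z" and N: "prob_space N"
  shows "bounded_in_prob (\<lambda>n \<omega>. norm (U n \<omega>))"
  unfolding bounded_in_prob_def
proof (intro allI impI)
  fix \<tau> :: real assume \<tau>: "\<tau> > 0"
  interpret N: prob_space N by fact
  have [measurable]: "U n \<in> borel_measurable M" "Z \<in> borel_measurable N" for n
    using conv by (auto simp: converges_in_distribution_def)
  define g where "g B x = min 1 (max 0 (norm x - B))" for B :: real and x :: 'b
  have g_cont: "continuous_on UNIV (g B)" for B
    unfolding g_def by (intro continuous_intros)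
  have g_le: "0 \<le> g B x" "g B x \<le> 1" for B x by (auto simp: g_def)
  have g_bdd: "bounded (range (g B))" for B
    using g_le by (intro boundedI[of _ 1]) auto
  have [measurable]: "g B \<in> borel_measurable borel" for B
    using g_cont by (rule borel_measurable_continuous_onI)
  have "(\<lambda>k. \<integral>v. g (real k) (Z v) \<partial>N) \<longlonglongrightarrow> (\<integral>v. 0 \<partial>N)"
  proof (rule integral_dominated_convergence[where w = "\<lambda>_. 1"])
    show "AE v in N. (\<lambda>k. g (real k) (Z v)) \<longlonglongrightarrow> 0"
    proof (rule AE_I2)
      fix v
      obtain k0 where "norm (Z v) \<le> real k0" using real_arch_simple by blast
      then have "\<forall>k\<ge>k0. g (real k) (Z v) = 0" by (auto simp: g_def)
      then show "(\<lambda>k. g (real k) (Z v)) \<longlonglongrightarrow> 0"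
        by (metis (mono_tags, lifting) eventually_sequentiallyI tendsto_eventually)
    qed
    show "AE v in N. norm (g (real k) (Z v)) \<le> 1" for k using g_le by simp
  qed auto
  then have "\<forall>\<^sub>F k in sequentially. (\<integral>v. g (real k) (Z v) \<partial>N) < \<tau>"
    using \<tau> by (intro order_tendstoD) auto
  then obtain k where k: "(\<integral>v. g (real k) (Z v) \<partial>N) < \<tau>"
    by (auto simp: eventually_sequentially)
  have "(\<lambda>n. expectation (\<lambda>\<omega>. g (real k) (U n \<omega>))) \<longlonglongrightarrow> (\<integral>v. g (real k) (Z v) \<partial>N)"
    using conv g_cont[of k] g_bdd[of k] by (auto simp: converges_in_distribution_def)
  then have "\<forall>\<^sub>F n in sequentially. expectation (\<lambda>\<omega>. g (real k) (U n \<omega>)) < \<tau>"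
    using k by (rule order_tendstoD)
  then have "\<forall>\<^sub>F n in sequentially. prob {\<omega> \<in> space M. real k + 1 < norm (U n \<omega>)} \<le> \<tau>"
  proof eventually_elim
    case (elim n)
    have "prob {\<omega> \<in> space M. real k + 1 < norm (U n \<omega>)}
        = expectation (indicator {\<omega> \<in> space M. real k + 1 < norm (U n \<omega>)})"
      by (simp add: Int_def conj_commute)
    also have "\<dots> \<le> expectation (\<lambda>\<omega>. g (real k) (U n \<omega>))"
    proof (rule integral_mono)
      show "integrable M (\<lambda>\<omega>. g (real k) (U n \<omega>))"
        by (rule integrable_const_bound[where B = 1]) (use g_le in auto)
      show "indicator {\<omega> \<in> space M. real k + 1 < norm (U n \<omega>)} \<omega> \<le> g (real k) (U n \<omega>)"
        if "\<omega> \<in> space M" for \<omega>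
        using g_le by (auto simp: indicator_def g_def)
    qed (auto intro!: integrable_real_indicator emeasure_finite simp: less_top[symmetric])
    finally show ?case using elim by simp
  qed
  then show "\<exists>B. \<forall>\<^sub>F n in sequentially. prob {\<omega> \<in> space M. B < norm (U n \<omega>)} \<le> \<tau>" by blast
qed

end

section \<open>Moments of the model\<close>

context functional_linear_model
begin

declare X_measurable[measurable] Y_measurable[measurable]

lemma integrable_X_inner_sq: "integrable M (\<lambda>\<omega>. (X \<omega> \<bullet> h)\<^sup>2)"
proof (rule Bochner_Integration.integrable_bound)
  show "integrable M (\<lambda>\<omega>. (norm (X \<omega>))\<^sup>2 * (norm h)\<^sup>2)"
    using X_square_integrable by simp
  show "AE \<omega> in M. norm ((X \<omega> \<bullet> h)\<^sup>2) \<le> norm ((norm (X \<omega>))\<^sup>2 * (norm h)\<^sup>2)"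
    using Cauchy_Schwarz_ineq2 by (intro AE_I2) (auto simp: power_mult_distrib[symmetric] abs_le_square_iff[symmetric])
qed simp

lemma integrable_covariance_integrand: "integrable M (\<lambda>\<omega>. (X \<omega> \<bullet> h) *\<^sub>R X \<omega>)"
proof (rule Bochner_Integration.integrable_bound)
  show "integrable M (\<lambda>\<omega>. (norm (X \<omega>))\<^sup>2 * norm h)"
    using X_square_integrable by simp
  show "AE \<omega> in M. norm ((X \<omega> \<bullet> h) *\<^sub>R X \<omega>) \<le> norm ((norm (X \<omega>))\<^sup>2 * norm h)"
  proof (rule AE_I2)
    fix \<omega>
    have "\<bar>X \<omega> \<bullet> h\<bar> * norm (X \<omega>) \<le> (norm (X \<omega>) * norm h) * norm (X \<omega>)"
      by (intro mult_right_mono Cauchy_Schwarz_ineq2) auto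
    then show "norm ((X \<omega> \<bullet> h) *\<^sub>R X \<omega>) \<le> norm ((norm (X \<omega>))\<^sup>2 * norm h)"
      by (simp add: power2_eq_square mult_ac)
  qed
qed simp

lemma inner_covariance_op:
  "covariance_op M X h \<bullet> k = expectation (\<lambda>\<omega>. (X \<omega> \<bullet> h) * (X \<omega> \<bullet> k))"
  unfolding covariance_op_def
  by (subst integral_inner_left[symmetric]) (auto intro: integrable_covariance_integrand)

lemma covariance_op_symmetric: "covariance_op M X h \<bullet> k = h \<bullet> covariance_op M X k"
  by (subst (2) inner_commute) (simp add: inner_covariance_op mult.commute)

lemma covariance_op_scaleR: "covariance_op M X (a *\<^sub>R h) = a *\<^sub>R covariance_op M X h"
  unfolding covariance_op_def
  by (subst integral_scaleR_right[symmetric]) (auto intro: integrable_covariance_integrand)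

lemma eigenvector_orthonormal: "e i \<bullet> e j = (if i = j then 1 else 0)"
  using eigen by (auto simp: eigensystem_def)

lemma covariance_op_eigenvector: "covariance_op M X (e j) = lam j *\<^sub>R e j"
  using eigen by (auto simp: eigensystem_def)

lemma eigenvalue_second_moment: "expectation (\<lambda>\<omega>. (X \<omega> \<bullet> e j)\<^sup>2) = lam j"
  using inner_covariance_op[of "e j" "e j"]
  by (simp add: covariance_op_eigenvector eigenvector_orthonormal power2_eq_square)

text \<open>The covariance operator is trace class: its trace is \<open>E \<parallel>X\<parallel>\<^sup>2\<close>.\<close>
lemma eigenvalues_tendsto_zero: "lam \<longlonglongrightarrow> 0"
proof (rule summable_LIMSEQ_zero, rule summableI_nonneg_bounded)
  fix n
  have "(\<Sum>i<n. lam i) = expectation (\<lambda>\<omega>. \<Sum>i<n. (X \<omega> \<bullet> e i)\<^sup>2)"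
    by (simp add: Bochner_Integration.integral_sum integrable_X_inner_sq eigenvalue_second_moment)
  also have "\<dots> \<le> expectation (\<lambda>\<omega>. (norm (X \<omega>))\<^sup>2)"
    by (intro integral_mono Bochner_Integration.integrable_sum integrable_X_inner_sq
        X_square_integrable)
      (use bessel_inequality[of e "{..<n}", OF eigenvector_orthonormal] in \<open>simp add: inner_commute\<close>)
  finally show "(\<Sum>i<n. lam i) \<le> expectation (\<lambda>\<omega>. (norm (X \<omega>))\<^sup>2)" .
qed (use lam_pos less_imp_le in auto)

abbreviation rho :: 'h where "rho \<equiv> slope M X Y lam e"
abbreviation err :: "'w \<Rightarrow> real" where "err \<equiv> model_error M X Y lam e"

lemma err_measurable [measurable]: "err \<in> borel_measurable M"
  unfolding model_error_def by simp

lemma err_square_integrable: "integrable M (\<lambda>\<omega>. (err \<omega>)\<^sup>2)"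
proof (rule Bochner_Integration.integrable_bound)
  show "integrable M (\<lambda>\<omega>. 2 * (Y \<omega>)\<^sup>2 + 2 * (X \<omega> \<bullet> rho)\<^sup>2)"
    using Y_square_integrable integrable_X_inner_sq by auto
  have "(a - b)\<^sup>2 \<le> 2 * a\<^sup>2 + 2 * b\<^sup>2" for a b :: real
    using zero_le_power2[of "a + b"] by (simp add: power2_eq_square algebra_simps)
  then show "AE \<omega> in M. norm ((err \<omega>)\<^sup>2) \<le> norm (2 * (Y \<omega>)\<^sup>2 + 2 * (X \<omega> \<bullet> rho)\<^sup>2)"
    by (intro AE_I2) (auto simp: model_error_def inner_commute)
qed simp

lemma finite_subalgebra_X: "finite_measure_subalgebra M (vimage_algebra (space M) X borel)"
proof
  show "subalgebra M (vimage_algebra (space M) X borel)"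
    using sets_image_in_sets[of M "space M" X borel] by (auto simp: subalgebra_def)
qed

lemma function_of_X_measurable:
  assumes [measurable]: "g \<in> borel_measurable borel"
  shows "(\<lambda>\<omega>. g (X \<omega>)) \<in> borel_measurable (vimage_algebra (space M) X borel)"
proof -
  have [measurable]: "X \<in> vimage_algebra (space M) X borel \<rightarrow>\<^sub>M borel"
    by (intro measurable_vimage_algebra1) simp
  show ?thesis by measurable
qed

lemma expectation_err_X_inner:
  "expectation (\<lambda>\<omega>. err \<omega> * (X \<omega> \<bullet> h)) = 0"
proof -
  interpret F: finite_measure_subalgebra M "vimage_algebra (space M) X borel"
    by (rule finite_subalgebra_X)
  have int: "integrable M (\<lambda>\<omega>. (X \<omega> \<bullet> h) * err \<omega>)"
    using integrable_inner_of_squares[of "\<lambda>\<omega>. X \<omega> \<bullet> h" err] integrable_X_inner_sq err_square_integrable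
    by simp
  have meas: "(\<lambda>\<omega>. X \<omega> \<bullet> h) \<in> borel_measurable (vimage_algebra (space M) X borel)"
    by (rule function_of_X_measurable) simp
  have "expectation (\<lambda>\<omega>. (X \<omega> \<bullet> h) * err \<omega>)
      = expectation (\<lambda>\<omega>. (X \<omega> \<bullet> h) * real_cond_exp M (vimage_algebra (space M) X borel) err \<omega>)"
    by (rule F.real_cond_exp_intg(2)[symmetric, OF int meas]) simp
  also have "\<dots> = expectation (\<lambda>\<omega>. 0)"
    by (intro integral_cong_AE) (use error_mean in auto)
  finally show ?thesis by (simp add: mult.commute)
qed

text \<open>Integrability of the product is part of the conclusion, so the conditional variance is used under
  the nonnegative integral.\<close>
lemma expectation_err_sq_function_of_X:
  fixes g :: "'h \<Rightarrow> real"
  assumes g[measurable]: "g \<in> borel_measurable borel" and g_nonneg: "\<And>x. 0 \<le> g x"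
    and int: "integrable M (\<lambda>\<omega>. g (X \<omega>))"
  shows "integrable M (\<lambda>\<omega>. g (X \<omega>) * (err \<omega>)\<^sup>2)"
    and "expectation (\<lambda>\<omega>. g (X \<omega>) * (err \<omega>)\<^sup>2) = sigma_eps\<^sup>2 * expectation (\<lambda>\<omega>. g (X \<omega>))"
proof -
  let ?F = "vimage_algebra (space M) X borel"
  interpret F: finite_measure_subalgebra M ?F
    by (rule finite_subalgebra_X)
  have zero: "AE \<omega> in M. 0 = nn_cond_exp M ?F (\<lambda>_. 0) \<omega>"
    by (rule F.nn_cond_exp_F_meas) simp
  have ce: "AE \<omega> in M. nn_cond_exp M ?F (\<lambda>\<omega>. ennreal ((err \<omega>)\<^sup>2)) \<omega> = ennreal (sigma_eps\<^sup>2)"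
    using error_variance zero
  proof eventually_elim
    case (elim \<omega>)
    have "(\<lambda>\<omega>. ennreal (- (err \<omega>)\<^sup>2)) = (\<lambda>_. 0)" by (simp add: ennreal_neg)
    then have "enn2real (nn_cond_exp M ?F (\<lambda>\<omega>. ennreal ((err \<omega>)\<^sup>2)) \<omega>) = sigma_eps\<^sup>2"
      using elim by (simp add: real_cond_exp_def)
    \<comment> \<open>an infinite value would be sent to 0, but \<open>sigma_eps\<close> is positive\<close>
    then show ?case
      using sigma_eps_pos by (cases "nn_cond_exp M ?F (\<lambda>\<omega>. ennreal ((err \<omega>)\<^sup>2)) \<omega>") auto
  qed
  have meas: "(\<lambda>\<omega>. ennreal (g (X \<omega>))) \<in> borel_measurable ?F"
    by (rule measurable_compose[OF function_of_X_measurable[OF g] measurable_ennreal])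
  have "(\<integral>\<^sup>+\<omega>. ennreal (g (X \<omega>) * (err \<omega>)\<^sup>2) \<partial>M)
      = (\<integral>\<^sup>+\<omega>. ennreal (g (X \<omega>)) * ennreal ((err \<omega>)\<^sup>2) \<partial>M)"
    by (simp add: ennreal_mult g_nonneg)
  also have "\<dots> = (\<integral>\<^sup>+\<omega>. ennreal (g (X \<omega>)) * nn_cond_exp M ?F (\<lambda>\<omega>. ennreal ((err \<omega>)\<^sup>2)) \<omega> \<partial>M)"
    by (rule F.nn_cond_exp_intg[symmetric, OF meas]) simp
  also have "\<dots> = (\<integral>\<^sup>+\<omega>. ennreal (g (X \<omega>)) * ennreal (sigma_eps\<^sup>2) \<partial>M)"
    by (intro nn_integral_cong_AE) (use ce in auto)
  also have "\<dots> = (\<integral>\<^sup>+\<omega>. ennreal (g (X \<omega>) * sigma_eps\<^sup>2) \<partial>M)"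
    by (simp add: ennreal_mult g_nonneg)
  also have "\<dots> = ennreal (expectation (\<lambda>\<omega>. g (X \<omega>) * sigma_eps\<^sup>2))"
    by (intro nn_integral_eq_integral) (use int g_nonneg in auto)
  finally have nn: "(\<integral>\<^sup>+\<omega>. ennreal (g (X \<omega>) * (err \<omega>)\<^sup>2) \<partial>M)
      = ennreal (sigma_eps\<^sup>2 * expectation (\<lambda>\<omega>. g (X \<omega>)))"
    by (simp add: mult.commute)
  have E_nonneg: "0 \<le> expectation (\<lambda>\<omega>. g (X \<omega>))" using g_nonneg by simp
  show I: "integrable M (\<lambda>\<omega>. g (X \<omega>) * (err \<omega>)\<^sup>2)"
    by (rule integrableI_nonneg) (use nn g_nonneg in auto)
  show "expectation (\<lambda>\<omega>. g (X \<omega>) * (err \<omega>)\<^sup>2) = sigma_eps\<^sup>2 * expectation (\<lambda>\<omega>. g (X \<omega>))"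
    using nn E_nonneg by (intro integral_eq_nn_integral[THEN trans]) (auto simp: g_nonneg)
qed

lemma err_X_square_integrable: "integrable M (\<lambda>\<omega>. (norm (err \<omega> *\<^sub>R X \<omega>))\<^sup>2)"
  using expectation_err_sq_function_of_X(1)[of "\<lambda>x. (norm x)\<^sup>2"] X_square_integrable
  by (simp add: power_mult_distrib mult.commute)

lemma expectation_err_X: "expectation (\<lambda>\<omega>. err \<omega> *\<^sub>R X \<omega>) = 0"
proof -
  have int: "integrable M (\<lambda>\<omega>. err \<omega> *\<^sub>R X \<omega>)"
    by (rule integrable_of_square_norm[OF _ err_X_square_integrable]) simp
  let ?m = "expectation (\<lambda>\<omega>. err \<omega> *\<^sub>R X \<omega>)"
  have "?m \<bullet> ?m = expectation (\<lambda>\<omega>. (err \<omega> *\<^sub>R X \<omega>) \<bullet> ?m)"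
    by (rule integral_inner_left[symmetric]) (rule int)
  also have "\<dots> = 0" using expectation_err_X_inner by simp
  finally show ?thesis by simp
qed

end

section \<open>Transfer to the sample\<close>

context prob_space
begin

lemma iid_copies_transform:
  fixes X :: "'a \<Rightarrow> 'h::{real_inner, banach, second_countable_topology}"
    and \<phi> :: "'h \<times> real \<Rightarrow> 'k::{banach, second_countable_topology}"
  assumes iid: "iid_copies M X Y Xs Ys"
    and [measurable]: "X \<in> borel_measurable M" "Y \<in> borel_measurable M"
    and \<phi>[measurable]: "\<phi> \<in> borel_measurable (borel \<Otimes>\<^sub>M borel)"
  shows "indep_vars (\<lambda>_. borel) (\<lambda>i \<omega>. \<phi> (Xs i \<omega>, Ys i \<omega>)) UNIV"
    and "distr M borel (\<lambda>\<omega>. \<phi> (Xs i \<omega>, Ys i \<omega>)) = distr M borel (\<lambda>\<omega>. \<phi> (X \<omega>, Y \<omega>))"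
    and "integrable M (\<lambda>\<omega>. \<phi> (Xs i \<omega>, Ys i \<omega>)) \<longleftrightarrow> integrable M (\<lambda>\<omega>. \<phi> (X \<omega>, Y \<omega>))"
    and "expectation (\<lambda>\<omega>. \<phi> (Xs i \<omega>, Ys i \<omega>)) = expectation (\<lambda>\<omega>. \<phi> (X \<omega>, Y \<omega>))"
proof -
  have ind: "indep_vars (\<lambda>_. borel \<Otimes>\<^sub>M borel) (\<lambda>i \<omega>. (Xs i \<omega>, Ys i \<omega>)) UNIV"
    and distr: "distr M (borel \<Otimes>\<^sub>M borel) (\<lambda>\<omega>. (Xs i \<omega>, Ys i \<omega>)) =
          distr M (borel \<Otimes>\<^sub>M borel) (\<lambda>\<omega>. (X \<omega>, Y \<omega>))"
    using iid by (auto simp: iid_copies_def)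
  have m[measurable]: "(\<lambda>\<omega>. (Xs i \<omega>, Ys i \<omega>)) \<in> M \<rightarrow>\<^sub>M borel \<Otimes>\<^sub>M borel"
    using ind by (auto simp: indep_vars_def)
  have m'[measurable]: "(\<lambda>\<omega>. (X \<omega>, Y \<omega>)) \<in> M \<rightarrow>\<^sub>M borel \<Otimes>\<^sub>M borel"
    by measurable
  show "indep_vars (\<lambda>_. borel) (\<lambda>i \<omega>. \<phi> (Xs i \<omega>, Ys i \<omega>)) UNIV"
    by (rule indep_vars_compose2[OF ind]) (rule \<phi>)
  show "distr M borel (\<lambda>\<omega>. \<phi> (Xs i \<omega>, Ys i \<omega>)) = distr M borel (\<lambda>\<omega>. \<phi> (X \<omega>, Y \<omega>))"
    using distr_distr[OF \<phi> m] distr_distr[OF \<phi> m'] distr by (simp add: o_def)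
  show "integrable M (\<lambda>\<omega>. \<phi> (Xs i \<omega>, Ys i \<omega>)) \<longleftrightarrow> integrable M (\<lambda>\<omega>. \<phi> (X \<omega>, Y \<omega>))"
    using integrable_distr_eq[OF m \<phi>] integrable_distr_eq[OF m' \<phi>] distr by simp
  show "expectation (\<lambda>\<omega>. \<phi> (Xs i \<omega>, Ys i \<omega>)) = expectation (\<lambda>\<omega>. \<phi> (X \<omega>, Y \<omega>))"
    using integral_distr[OF m \<phi>] integral_distr[OF m' \<phi>] distr by simp
qed

lemma iid_copies_bounded_in_prob:
  fixes X :: "'a \<Rightarrow> 'h::{real_inner, banach, second_countable_topology}"
    and \<phi> :: "'h \<times> real \<Rightarrow> 'k::{real_inner, banach, second_countable_topology}"
  assumes iid: "iid_copies M X Y Xs Ys"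
    and XY: "X \<in> borel_measurable M" "Y \<in> borel_measurable M"
    and \<phi>[measurable]: "\<phi> \<in> borel_measurable (borel \<Otimes>\<^sub>M borel)"
    and sq: "integrable M (\<lambda>\<omega>. (norm (\<phi> (X \<omega>, Y \<omega>)))\<^sup>2)"
    and mean: "expectation (\<lambda>\<omega>. \<phi> (X \<omega>, Y \<omega>)) = 0"
  shows "bounded_in_prob (\<lambda>n \<omega>. sqrt n * norm ((1 / real n) *\<^sub>R (\<Sum>i<n. \<phi> (Xs i \<omega>, Ys i \<omega>))))"
proof (rule bounded_in_prob_root_n_mean)
  have sqm: "(\<lambda>z. (norm (\<phi> z))\<^sup>2) \<in> borel_measurable (borel \<Otimes>\<^sub>M borel)" by measurable
  show "indep_vars (\<lambda>_. borel) (\<lambda>i \<omega>. \<phi> (Xs i \<omega>, Ys i \<omega>)) UNIV"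
    by (rule iid_copies_transform(1)[OF iid XY \<phi>])
  show "integrable M (\<lambda>\<omega>. (norm (\<phi> (Xs i \<omega>, Ys i \<omega>)))\<^sup>2)" for i
    using iid_copies_transform(3)[OF iid XY sqm] sq by simp
  show "expectation (\<lambda>\<omega>. \<phi> (Xs i \<omega>, Ys i \<omega>)) = 0" for i
    using iid_copies_transform(4)[OF iid XY \<phi>] mean by simp
  show "expectation (\<lambda>\<omega>. (norm (\<phi> (Xs i \<omega>, Ys i \<omega>)))\<^sup>2) = expectation (\<lambda>\<omega>. (norm (\<phi> (X \<omega>, Y \<omega>)))\<^sup>2)" for i
    using iid_copies_transform(4)[OF iid XY sqm] by simp
qed

end

section \<open>Small balls under the central limit theorem\<close>

lemma std_normal_distribution_interval_le:
  assumes "a < b"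
  shows "measure std_normal_distribution {a<..b} \<le> b - a"
proof -
  have d: "std_normal_density x \<le> 1" for x
  proof -
    have "exp (- x\<^sup>2 / 2) / sqrt (2 * pi) \<le> 1 / 1"
      using pi_gt3 by (intro frac_le) auto
    then show ?thesis by (simp add: std_normal_density_def)
  qed
  have "emeasure std_normal_distribution {a<..b}
      = (\<integral>\<^sup>+x. ennreal (std_normal_density x) * indicator {a<..b} x \<partial>lborel)"
    by (rule emeasure_density) auto
  also have "\<dots> \<le> (\<integral>\<^sup>+x. indicator {a<..b} x \<partial>lborel)"
    using d by (intro nn_integral_mono) (auto simp: indicator_def)
  also have "\<dots> = ennreal (b - a)" using assms by simp
  finally show ?thesis
    using assms by (simp add: measure_def enn2real_leI)
qed

lemma isCont_cdf_std_normal: "isCont (cdf std_normal_distribution) x"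
proof -
  interpret real_distribution std_normal_distribution by (rule real_dist_normal_dist)
  have "emeasure std_normal_distribution {x}
      = (\<integral>\<^sup>+y. ennreal (std_normal_density y) * indicator {x} y \<partial>lborel)"
    by (rule emeasure_density) auto
  also have "\<dots> = (\<integral>\<^sup>+(y::real). 0 \<partial>lborel)"
    by (intro nn_integral_cong_AE) (use AE_lborel_singleton[of x] in \<open>auto simp: indicator_def\<close>)
  finally show ?thesis by (simp add: isCont_cdf measure_def)
qed

context prob_space
begin

text \<open>The density of the limit is below 1, so an interval of length \<open>3 * \<delta>\<close> has mass less than
  \<open>4 * \<delta>\<close>.\<close>
lemma clt_small_ball:
  fixes \<xi> :: "nat \<Rightarrow> 'a \<Rightarrow> real" and s \<delta> :: real
  assumes ind: "indep_vars (\<lambda>_. borel) \<xi> UNIV"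
    and distr: "\<And>i. distr M borel (\<xi> i) = \<mu>"
    and mean: "\<And>i. expectation (\<xi> i) = 0"
    and sq: "\<And>i. integrable M (\<lambda>\<omega>. (\<xi> i \<omega>)\<^sup>2)"
    and var: "\<And>i. expectation (\<lambda>\<omega>. (\<xi> i \<omega>)\<^sup>2) = s\<^sup>2" and s: "s > 0" and \<delta>: "\<delta> > 0"
  shows "\<forall>\<^sub>F n in sequentially. prob {\<omega> \<in> space M. \<bar>(\<Sum>i<n. \<xi> i \<omega>) / sqrt (n * s\<^sup>2)\<bar> \<le> \<delta>} < 4 * \<delta>"
proof -
  have [measurable]: "\<xi> i \<in> borel_measurable M" for i
    using ind by (auto simp: indep_vars_def)
  define F where "F n = distr M borel (\<lambda>\<omega>. (\<Sum>i<n. \<xi> i \<omega>) / sqrt (n * s\<^sup>2))" for n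
  interpret N: real_distribution std_normal_distribution by (rule real_dist_normal_dist)
  have "weak_conv_m F std_normal_distribution"
    unfolding F_def
    by (rule central_limit_theorem_zero_mean) (use ind mean s sq var distr in auto)
  then have cdf: "(\<lambda>n. cdf (F n) x) \<longlonglongrightarrow> cdf std_normal_distribution x" for x
    using isCont_cdf_std_normal by (auto simp: weak_conv_m_def weak_conv_def)
  \<comment> \<open>the left end is moved to \<open>- 2 * \<delta>\<close> because differences of distribution functions omit it\<close>
  have "(\<lambda>n. cdf (F n) \<delta> - cdf (F n) (- 2 * \<delta>))
      \<longlonglongrightarrow> cdf std_normal_distribution \<delta> - cdf std_normal_distribution (- 2 * \<delta>)"
    by (intro tendsto_diff cdf)
  moreover have "cdf std_normal_distribution \<delta> - cdf std_normal_distribution (- 2 * \<delta>) < 4 * \<delta>"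
    using std_normal_distribution_interval_le[of "- 2 * \<delta>" \<delta>] \<delta> by (simp add: N.cdf_diff_eq)
  ultimately have "\<forall>\<^sub>F n in sequentially. cdf (F n) \<delta> - cdf (F n) (- 2 * \<delta>) < 4 * \<delta>"
    by (rule order_tendstoD)
  then show ?thesis
  proof eventually_elim
    case (elim n)
    interpret Fn: real_distribution "F n"
      unfolding F_def by (rule real_distribution_distr) simp
    have "prob {\<omega> \<in> space M. \<bar>(\<Sum>i<n. \<xi> i \<omega>) / sqrt (n * s\<^sup>2)\<bar> \<le> \<delta>}
        \<le> prob ((\<lambda>\<omega>. (\<Sum>i<n. \<xi> i \<omega>) / sqrt (n * s\<^sup>2)) -` {- 2 * \<delta><..\<delta>} \<inter> space M)"
      using \<delta> by (intro finite_measure_mono) (auto simp: abs_le_iff simp del: abs_divide)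
    also have "\<dots> = measure (F n) {- 2 * \<delta><..\<delta>}"
      unfolding F_def by (subst measure_distr) auto
    also have "\<dots> = cdf (F n) \<delta> - cdf (F n) (- 2 * \<delta>)"
      using \<delta> by (intro Fn.cdf_diff_eq[symmetric]) auto
    finally show ?case using elim by linarith
  qed
qed

end

section \<open>The estimation error on the scale of root \<open>n\<close>\<close>

locale slope_estimation =
  functional_linear_model M X Y lam e sigma_eps + regularization_scheme lam c f
  for M :: "'w measure" and X :: "'w \<Rightarrow> 'h::{real_inner, banach, second_countable_topology}"
    and Y :: "'w \<Rightarrow> real" and lam :: "nat \<Rightarrow> real" and e :: "nat \<Rightarrow> 'h" and sigma_eps :: real
    and c :: "nat \<Rightarrow> real" and f :: "nat \<Rightarrow> real \<Rightarrow> real" +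
  fixes Xs :: "nat \<Rightarrow> 'w \<Rightarrow> 'h" and Ys :: "nat \<Rightarrow> 'w \<Rightarrow> real"
    and lhat :: "nat \<Rightarrow> 'w \<Rightarrow> nat \<Rightarrow> real" and ehat :: "nat \<Rightarrow> 'w \<Rightarrow> nat \<Rightarrow> 'h"
  assumes sample: "iid_copies M X Y Xs Ys"
    and empirical_eigen:
      "\<And>n \<omega>. \<omega> \<in> space M \<Longrightarrow> eigensystem (empirical_cov Xs n \<omega>) (lhat n \<omega>) (ehat n \<omega>)"
    and fourth_moment: "integrable M (\<lambda>\<omega>. (norm (X \<omega>)) ^ 4)"
    and rate: "(\<lambda>n. SUP s\<in>{c n..}. \<bar>s * f n s - 1\<bar>) \<in> o(\<lambda>n. 1 / sqrt (real n))"
begin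

abbreviation Cov :: "'h \<Rightarrow> 'h" where "Cov \<equiv> covariance_op M X"
abbreviation Cov_n :: "nat \<Rightarrow> 'w \<Rightarrow> 'h \<Rightarrow> 'h" where "Cov_n \<equiv> empirical_cov Xs"

definition est_error :: "nat \<Rightarrow> 'w \<Rightarrow> 'h" where
  "est_error n \<omega> = slope_estimator Xs Ys f lhat ehat n \<omega> - rho"

definition noise :: "nat \<Rightarrow> 'w \<Rightarrow> 'h" where
  "noise n \<omega> = (1 / real n) *\<^sub>R (\<Sum>i<n. (Ys i \<omega> - rho \<bullet> Xs i \<omega>) *\<^sub>R Xs i \<omega>)"

text \<open>Relative error of \<open>f n\<close> as an inverse, above the cutoff.\<close>
definition bias :: "nat \<Rightarrow> real" where
  "bias n = (SUP s\<in>{c n..}. \<bar>s * f n s - 1\<bar>)"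

text \<open>Everything random in the remainder apart from the error itself, gathered in one variable so that
  a single bound in probability controls it.\<close>
definition fluctuation :: "'h \<Rightarrow> nat \<Rightarrow> 'w \<Rightarrow> real" where
  "fluctuation k n \<omega> = sqrt n * norm (noise n \<omega>) + sqrt n * norm (Cov_n n \<omega> (Cov k) - Cov (Cov k))
     + sqrt n * norm (Cov_n n \<omega> k - Cov k) + sqrt n * norm (Cov_n n \<omega> rho - Cov rho)"

lemma sample_measurable [measurable]:
  "Xs i \<in> borel_measurable M" "Ys i \<in> borel_measurable M"
proof -
  have "(\<lambda>\<omega>. (Xs i \<omega>, Ys i \<omega>)) \<in> M \<rightarrow>\<^sub>M borel \<Otimes>\<^sub>M borel"
    using sample by (auto simp: iid_copies_def indep_vars_def)
  from measurable_compose[OF this measurable_fst] measurable_compose[OF this measurable_snd]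
  show "Xs i \<in> borel_measurable M" "Ys i \<in> borel_measurable M" by simp_all
qed

lemma noise_measurable [measurable]: "noise n \<in> borel_measurable M"
  unfolding noise_def by measurable

lemma Cov_n_measurable [measurable]: "(\<lambda>\<omega>. Cov_n n \<omega> h) \<in> borel_measurable M"
  unfolding empirical_cov_def by measurable

lemma fluctuation_measurable [measurable]: "fluctuation k n \<in> borel_measurable M"
  unfolding fluctuation_def by measurable

lemma bounded_in_prob_noise: "bounded_in_prob (\<lambda>n \<omega>. sqrt n * norm (noise n \<omega>))"
proof -
  define \<phi> where "\<phi> = (\<lambda>(x, y). (y - rho \<bullet> x) *\<^sub>R x)"
  have [measurable]: "\<phi> \<in> borel_measurable (borel \<Otimes>\<^sub>M borel)" unfolding \<phi>_def by measurable
  have "\<phi> (X \<omega>, Y \<omega>) = err \<omega> *\<^sub>R X \<omega>" for \<omega> by (simp add: \<phi>_def model_error_def)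
  then have "bounded_in_prob
      (\<lambda>n \<omega>. sqrt n * norm ((1 / real n) *\<^sub>R (\<Sum>i<n. \<phi> (Xs i \<omega>, Ys i \<omega>))))"
    using err_X_square_integrable expectation_err_X
    by (intro iid_copies_bounded_in_prob[OF sample]) auto
  then show ?thesis by (simp only: noise_def \<phi>_def case_prod_conv)
qed

text \<open>The summands \<open>\<langle>X\<^sub>i, h\<rangle> X\<^sub>i\<close> are quadratic in \<open>X\<^sub>i\<close>, so their second moment is controlled by the
  fourth moment of \<open>X\<close>.\<close>
lemma bounded_in_prob_Cov_n:
  "bounded_in_prob (\<lambda>n \<omega>. sqrt n * norm (Cov_n n \<omega> h - Cov h))"
proof -
  define \<phi> :: "'h \<times> real \<Rightarrow> 'h" where "\<phi> = (\<lambda>(x, y). (x \<bullet> h) *\<^sub>R x - Cov h)"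
  have [measurable]: "\<phi> \<in> borel_measurable (borel \<Otimes>\<^sub>M borel)" unfolding \<phi>_def by measurable
  have "integrable M (\<lambda>\<omega>. (norm (\<phi> (X \<omega>, Y \<omega>)))\<^sup>2)"
  proof (rule Bochner_Integration.integrable_bound)
    show "integrable M (\<lambda>\<omega>. 2 * (norm h)\<^sup>2 * (norm (X \<omega>)) ^ 4 + 2 * (norm (Cov h))\<^sup>2)"
      using fourth_moment by simp
    show "AE \<omega> in M. norm ((norm (\<phi> (X \<omega>, Y \<omega>)))\<^sup>2)
        \<le> norm (2 * (norm h)\<^sup>2 * (norm (X \<omega>)) ^ 4 + 2 * (norm (Cov h))\<^sup>2)"
    proof (rule AE_I2)
      fix \<omega>
      have sq: "(a + b)\<^sup>2 \<le> 2 * a\<^sup>2 + 2 * b\<^sup>2" for a b :: real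
        using zero_le_power2[of "a - b"] by (simp add: power2_eq_square algebra_simps)
      have "norm (\<phi> (X \<omega>, Y \<omega>)) \<le> norm h * (norm (X \<omega>))\<^sup>2 + norm (Cov h)"
      proof -
        have "norm (\<phi> (X \<omega>, Y \<omega>)) \<le> \<bar>X \<omega> \<bullet> h\<bar> * norm (X \<omega>) + norm (Cov h)"
          unfolding \<phi>_def by (simp add: norm_triangle_ineq4[THEN order_trans])
        also have "\<dots> \<le> (norm (X \<omega>) * norm h) * norm (X \<omega>) + norm (Cov h)"
          by (intro add_right_mono mult_right_mono Cauchy_Schwarz_ineq2) auto
        finally show ?thesis by (simp add: power2_eq_square mult_ac)
      qed
      then have "(norm (\<phi> (X \<omega>, Y \<omega>)))\<^sup>2 \<le> (norm h * (norm (X \<omega>))\<^sup>2 + norm (Cov h))\<^sup>2"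
        by (intro power_mono) auto
      also have "\<dots> \<le> 2 * (norm h)\<^sup>2 * (norm (X \<omega>)) ^ 4 + 2 * (norm (Cov h))\<^sup>2"
        using sq[of "norm h * (norm (X \<omega>))\<^sup>2" "norm (Cov h)"]
        by (simp add: power_mult_distrib mult.assoc power_mult[symmetric])
      finally show "norm ((norm (\<phi> (X \<omega>, Y \<omega>)))\<^sup>2)
          \<le> norm (2 * (norm h)\<^sup>2 * (norm (X \<omega>)) ^ 4 + 2 * (norm (Cov h))\<^sup>2)" by simp
    qed
  qed simp
  moreover have "expectation (\<lambda>\<omega>. \<phi> (X \<omega>, Y \<omega>)) = 0"
    using integrable_covariance_integrand[of h] by (simp add: \<phi>_def covariance_op_def prob_space)
  ultimately have "bounded_in_prob
      (\<lambda>n \<omega>. sqrt n * norm ((1 / real n) *\<^sub>R (\<Sum>i<n. \<phi> (Xs i \<omega>, Ys i \<omega>))))"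
    by (intro iid_copies_bounded_in_prob[OF sample]) auto
  moreover have "sqrt n * norm ((1 / real n) *\<^sub>R (\<Sum>i<n. \<phi> (Xs i \<omega>, Ys i \<omega>)))
      = sqrt n * norm (Cov_n n \<omega> h - Cov h)" for n \<omega>
  proof (cases "n = 0")
    case False
    then have "(1 / real n) *\<^sub>R (\<Sum>i<n. \<phi> (Xs i \<omega>, Ys i \<omega>)) = Cov_n n \<omega> h - Cov h"
      by (simp add: \<phi>_def empirical_cov_def sum_subtractf scaleR_diff_right sum_constant_scaleR)
    then show ?thesis by simp
  qed simp
  ultimately show ?thesis by simp
qed

lemma bounded_in_prob_fluctuation: "bounded_in_prob (fluctuation k)"
  unfolding fluctuation_def
  by (intro bounded_in_prob_add bounded_in_prob_noise bounded_in_prob_Cov_n) measurable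

lemma filter_vanishes_below: "s < c n \<Longrightarrow> f n s = 0"
  using closure_subset[of "{x. f n x \<noteq> 0}"] f_support[of n] by (auto simp: subset_iff)

lemma filter_deviation_le_bias: "\<forall>\<^sub>F n in sequentially. \<forall>s\<ge>c n. \<bar>s * f n s - 1\<bar> \<le> bias n"
  using f_deviation_bounded
  by eventually_elim (auto simp: bias_def intro!: cSUP_upper)

lemma bias_tendsto_zero: "bias \<longlonglongrightarrow> 0"
  using f_deviation_limit by (simp add: bias_def[abs_def])

lemma root_n_bias_tendsto_zero: "(\<lambda>n. sqrt n * bias n) \<longlonglongrightarrow> 0"
proof -
  have "(\<lambda>n. bias n / (1 / sqrt (real n))) \<longlonglongrightarrow> 0"
    using rate by (intro smalloD_tendsto) (simp add: bias_def[abs_def])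
  then show ?thesis by (simp add: mult.commute)
qed

lemma empirical_cross_cov_decomposition:
  "empirical_cross_cov Xs Ys n \<omega> = Cov_n n \<omega> rho + noise n \<omega>"
  unfolding empirical_cross_cov_def empirical_cov_def noise_def
  by (simp add: scaleR_add_right[symmetric] sum.distrib[symmetric] scaleR_add_left[symmetric]
      inner_commute[of rho])

lemma est_error_expansion:
  assumes \<omega>: "\<omega> \<in> space M" and dev: "\<forall>s\<ge>c n. \<bar>s * f n s - 1\<bar> \<le> bias n"
  shows "\<bar>est_error n \<omega> \<bullet> Cov (Cov k) - noise n \<omega> \<bullet> Cov k\<bar>
    \<le> norm (est_error n \<omega>) * (norm (Cov (Cov k) - Cov_n n \<omega> (Cov k)) + c n * norm (Cov k))
      + bias n * norm (Cov_n n \<omega> rho) * norm (Cov k)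
      + norm (noise n \<omega>) * (bias n * norm (Cov k) + norm (Cov k - Cov_n n \<omega> k) + c n * norm k)"
proof (rule spectral_cutoff_expansion[where v = "ehat n \<omega>" and l = "lhat n \<omega>" and g = "f n"
      and D = "regularized_inverse f lhat ehat n \<omega>" and r = rho and n = n and L = Cov])
  note es = empirical_eigen[OF \<omega>, of n]
  show "ehat n \<omega> i \<bullet> ehat n \<omega> j = (if i = j then 1 else 0)" for i j
    using es by (auto simp: eigensystem_def)
  show "0 \<le> lhat n \<omega> j" for j by (rule empirical_eigenvalue_nonneg[OF es])
  show "Cov_n n \<omega> x = (\<Sum>j<n. (lhat n \<omega> j * (ehat n \<omega> j \<bullet> x)) *\<^sub>R ehat n \<omega> j)" for x
    by (rule empirical_cov_spectral_decomposition[OF es])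
  show "est_error n \<omega> = regularized_inverse f lhat ehat n \<omega> (Cov_n n \<omega> rho + noise n \<omega>) - rho"
    by (simp add: est_error_def slope_estimator_def empirical_cross_cov_decomposition)
qed (use dev c_pos[of n] filter_vanishes_below in \<open>auto simp: regularized_inverse_def\<close>)

text \<open>On the event \<open>fluctuation k n \<omega> \<le> B\<close> the expansion becomes deterministic, with remainders \<open>p\<close>
  and \<open>q\<close> that do not depend on \<open>\<omega>\<close>. The bound keeps the factor \<open>norm (est_error n \<omega>)\<close> because
  its order of magnitude is not known: it is estimated only through the normalization under study.\<close>
lemma root_n_error_expansion:
  obtains p q :: "nat \<Rightarrow> real" where "p \<longlonglongrightarrow> 0" "q \<longlonglongrightarrow> 0"
    "\<forall>\<^sub>F n in sequentially. 0 \<le> p n \<and> 0 \<le> q n \<and> (\<forall>\<omega>\<in>space M. fluctuation k n \<omega> \<le> B \<longrightarrow>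
       sqrt n * \<bar>est_error n \<omega> \<bullet> Cov (Cov k) - noise n \<omega> \<bullet> Cov k\<bar>
         \<le> sqrt n * norm (est_error n \<omega>) * p n + q n)"
proof -
  define B' where "B' = max B 0"
  define p where "p n = B' / sqrt n + c n * norm (Cov k)" for n
  define q where "q n = (sqrt n * bias n) * (norm (Cov rho) + B' / sqrt n) * norm (Cov k)
      + B' * (bias n * norm (Cov k) + B' / sqrt n + c n * norm k)" for n
  have inv: "(\<lambda>n. B' / sqrt (real n)) \<longlonglongrightarrow> 0"
    by (intro tendsto_divide_0[OF tendsto_const] filterlim_at_top_imp_at_infinity
        filterlim_compose[OF sqrt_at_top filterlim_real_sequentially])
  have "p \<longlonglongrightarrow> 0 + 0 * norm (Cov k)"
    unfolding p_def by (intro tendsto_intros inv c_limit)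
  moreover have "q \<longlonglongrightarrow> 0 * (norm (Cov rho) + 0) * norm (Cov k)
      + B' * (0 * norm (Cov k) + 0 + 0 * norm k)"
    unfolding q_def by (intro tendsto_intros inv c_limit root_n_bias_tendsto_zero bias_tendsto_zero)
  moreover have "\<forall>\<^sub>F n in sequentially. 0 \<le> p n \<and> 0 \<le> q n \<and>
      (\<forall>\<omega>\<in>space M. fluctuation k n \<omega> \<le> B \<longrightarrow>
       sqrt n * \<bar>est_error n \<omega> \<bullet> Cov (Cov k) - noise n \<omega> \<bullet> Cov k\<bar>
         \<le> sqrt n * norm (est_error n \<omega>) * p n + q n)"
    using filter_deviation_le_bias eventually_gt_at_top[of 0]
  proof eventually_elim
    case (elim n)
    have bias: "0 \<le> bias n" using elim(1) by (force intro: order_trans[OF abs_ge_zero])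
    have B': "0 \<le> B'" and B'_le: "B \<le> B'" by (simp_all add: B'_def)
    note cn = less_imp_le[OF c_pos[of n]]
    have sn: "0 < sqrt (real n)" using elim by simp
    have "0 \<le> p n" unfolding p_def using B' cn by simp
    moreover have "0 \<le> q n" unfolding q_def using B' cn bias by simp
    moreover have "sqrt n * \<bar>est_error n \<omega> \<bullet> Cov (Cov k) - noise n \<omega> \<bullet> Cov k\<bar>
         \<le> sqrt n * norm (est_error n \<omega>) * p n + q n"
      if \<omega>: "\<omega> \<in> space M" and fl: "fluctuation k n \<omega> \<le> B" for \<omega>
    proof -
      have nn: "0 \<le> sqrt n * norm x" for x :: 'h by simp
      have part: "sqrt n * norm (noise n \<omega>) \<le> B'"
        "sqrt n * norm (Cov (Cov k) - Cov_n n \<omega> (Cov k)) \<le> B'"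
        "sqrt n * norm (Cov k - Cov_n n \<omega> k) \<le> B'"
        "sqrt n * norm (Cov_n n \<omega> rho - Cov rho) \<le> B'"
        using fl nn[of "noise n \<omega>"] nn[of "Cov_n n \<omega> (Cov k) - Cov (Cov k)"]
          nn[of "Cov_n n \<omega> k - Cov k"] nn[of "Cov_n n \<omega> rho - Cov rho"]
          B'_le
        unfolding fluctuation_def norm_minus_commute[of "Cov (Cov k)"] norm_minus_commute[of "Cov k"]
        by linarith+
      then have part': "norm (Cov (Cov k) - Cov_n n \<omega> (Cov k)) \<le> B' / sqrt n"
        "norm (Cov k - Cov_n n \<omega> k) \<le> B' / sqrt n" "norm (Cov_n n \<omega> rho - Cov rho) \<le> B' / sqrt n"
        using sn by (simp_all add: pos_le_divide_eq mult.commute)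
      have rho: "norm (Cov_n n \<omega> rho) \<le> norm (Cov rho) + B' / sqrt n"
        using part'(3) norm_triangle_ineq2[of "Cov_n n \<omega> rho" "Cov rho"] by linarith
      have "sqrt n * \<bar>est_error n \<omega> \<bullet> Cov (Cov k) - noise n \<omega> \<bullet> Cov k\<bar>
        \<le> sqrt n * (norm (est_error n \<omega>)
              * (norm (Cov (Cov k) - Cov_n n \<omega> (Cov k)) + c n * norm (Cov k))
            + bias n * norm (Cov_n n \<omega> rho) * norm (Cov k)
            + norm (noise n \<omega>) * (bias n * norm (Cov k) + norm (Cov k - Cov_n n \<omega> k) + c n * norm k))"
        by (intro mult_left_mono est_error_expansion[OF \<omega> elim(1)]) simp
      also have "\<dots> = sqrt n * norm (est_error n \<omega>)
              * (norm (Cov (Cov k) - Cov_n n \<omega> (Cov k)) + c n * norm (Cov k))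
            + ((sqrt n * bias n) * norm (Cov_n n \<omega> rho) * norm (Cov k)
            + (sqrt n * norm (noise n \<omega>))
              * (bias n * norm (Cov k) + norm (Cov k - Cov_n n \<omega> k) + c n * norm k))"
        by (simp add: algebra_simps)
      also have "\<dots> \<le> sqrt n * norm (est_error n \<omega>) * p n + q n"
        unfolding p_def q_def using bias B' cn part part' rho
        by (intro add_mono mult_mono order_refl) auto
      finally show ?thesis .
    qed
    ultimately show ?case by blast
  qed
  ultimately show ?thesis using that by simp
qed

end

section \<open>Degeneracy of the limit\<close>

context slope_estimation
begin

text \<open>The coordinate of the noise along \<open>e p\<close> is a mean of independent copies of
  \<open>\<epsilon> \<langle>X, e p\<rangle>\<close>, whose variance is \<open>sigma_eps\<^sup>2 * lam p\<close> because the noise level is the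
  same given any value of \<open>X\<close>.\<close>
lemma noise_eigenvector_small_ball:
  assumes \<delta>: "\<delta> > 0"
  shows "\<forall>\<^sub>F n in sequentially.
    prob {\<omega> \<in> space M. sqrt n * \<bar>noise n \<omega> \<bullet> e p\<bar> \<le> \<delta> * (sigma_eps * sqrt (lam p))} < 4 * \<delta>"
proof -
  define \<phi> where "\<phi> = (\<lambda>(x, y). (y - rho \<bullet> x) * (x \<bullet> e p))"
  have \<phi>[measurable]: "\<phi> \<in> borel_measurable (borel \<Otimes>\<^sub>M borel)" unfolding \<phi>_def by measurable
  have sqm: "(\<lambda>z. (\<phi> z)\<^sup>2) \<in> borel_measurable (borel \<Otimes>\<^sub>M borel)" by measurable
  have \<phi>_XY: "\<phi> (X \<omega>, Y \<omega>) = err \<omega> * (X \<omega> \<bullet> e p)" for \<omega>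
    by (simp add: \<phi>_def model_error_def)
  define s where "s = sigma_eps * sqrt (lam p)"
  have s: "s > 0" "s\<^sup>2 = sigma_eps\<^sup>2 * lam p"
    using sigma_eps_pos lam_pos[of p] by (auto simp: s_def power_mult_distrib)
  note var = expectation_err_sq_function_of_X[of "\<lambda>x. (x \<bullet> e p)\<^sup>2", OF _ _ integrable_X_inner_sq]
  have var1: "integrable M (\<lambda>\<omega>. (\<phi> (X \<omega>, Y \<omega>))\<^sup>2)"
    and var2: "expectation (\<lambda>\<omega>. (\<phi> (X \<omega>, Y \<omega>))\<^sup>2) = s\<^sup>2"
    unfolding \<phi>_XY power_mult_distrib using var
    by (simp_all add: mult.commute eigenvalue_second_moment s(2))
  note iid = iid_copies_transform[OF sample X_measurable Y_measurable]
  have "\<forall>\<^sub>F n in sequentially.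
      prob {\<omega> \<in> space M. \<bar>(\<Sum>i<n. \<phi> (Xs i \<omega>, Ys i \<omega>)) / sqrt (n * s\<^sup>2)\<bar> \<le> \<delta>} < 4 * \<delta>"
  proof (rule clt_small_ball)
    show "indep_vars (\<lambda>_. borel) (\<lambda>i \<omega>. \<phi> (Xs i \<omega>, Ys i \<omega>)) UNIV" by (rule iid(1)[OF \<phi>])
    show "distr M borel (\<lambda>\<omega>. \<phi> (Xs i \<omega>, Ys i \<omega>)) = distr M borel (\<lambda>\<omega>. \<phi> (X \<omega>, Y \<omega>))" for i
      by (rule iid(2)[OF \<phi>])
    show "expectation (\<lambda>\<omega>. \<phi> (Xs i \<omega>, Ys i \<omega>)) = 0" for i
      unfolding iid(4)[OF \<phi>] \<phi>_XY by (rule expectation_err_X_inner)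
    show "integrable M (\<lambda>\<omega>. (\<phi> (Xs i \<omega>, Ys i \<omega>))\<^sup>2)" for i
      using iid(3)[OF sqm] var1 by simp
    show "expectation (\<lambda>\<omega>. (\<phi> (Xs i \<omega>, Ys i \<omega>))\<^sup>2) = s\<^sup>2" for i
      using iid(4)[OF sqm] var2 by simp
  qed (use s \<delta> in auto)
  then show ?thesis
    using eventually_gt_at_top[of 0]
  proof eventually_elim
    case (elim n)
    have "\<bar>(\<Sum>i<n. \<phi> (Xs i \<omega>, Ys i \<omega>)) / sqrt (n * s\<^sup>2)\<bar> \<le> \<delta>
        \<longleftrightarrow> sqrt n * \<bar>noise n \<omega> \<bullet> e p\<bar> \<le> \<delta> * s" for \<omega>
    proof -
      have "(\<Sum>i<n. \<phi> (Xs i \<omega>, Ys i \<omega>)) = n * (noise n \<omega> \<bullet> e p)"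
        using elim by (simp add: noise_def \<phi>_def inner_sum_left)
      moreover have "n / sqrt (n * s\<^sup>2) = sqrt n / s"
        using s(1) elim by (simp add: real_sqrt_mult real_div_sqrt flip: divide_divide_eq_left)
      ultimately have "(\<Sum>i<n. \<phi> (Xs i \<omega>, Ys i \<omega>)) / sqrt (n * s\<^sup>2)
          = (sqrt n / s) * (noise n \<omega> \<bullet> e p)"
        by (metis times_divide_eq_left)
      then show ?thesis using s(1) by (simp add: abs_mult pos_divide_le_eq)
    qed
    then show ?case using elim by (simp add: s_def)
  qed
qed

text \<open>The order of choices matters: the radius \<open>K\<close> comes from tightness, then \<open>p\<close> is taken so large
  that the coordinate of \<open>sqrt n *\<^sub>R est_error n \<omega>\<close> along \<open>e p\<close> exceeds \<open>K\<close> with high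
  probability, and only then the bound \<open>B\<close> for the fluctuation, which depends on \<open>p\<close>. If \<open>\<kappa> * sqrt n \<le> alpha n\<close>, three events of
  probabilities at most \<open>1/4\<close>, at most \<open>1/4\<close> and less than \<open>1/4\<close> would cover the whole space.\<close>
lemma normalization_slower_than_root_n:
  assumes alpha: "\<And>n. 0 < alpha n"
    and tight: "bounded_in_prob (\<lambda>n \<omega>. alpha n * norm (est_error n \<omega>))"
    and [measurable]: "\<And>n. est_error n \<in> borel_measurable M"
  shows "(\<lambda>n. alpha n / sqrt n) \<longlonglongrightarrow> 0"
proof (rule ccontr)
  assume "\<not> (\<lambda>n. alpha n / sqrt n) \<longlonglongrightarrow> 0"
  then obtain \<kappa> where \<kappa>: "\<kappa> > 0"
    and "\<not> (\<forall>\<^sub>F n in sequentially. dist (alpha n / sqrt n) 0 < \<kappa>)"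
    unfolding tendsto_iff by auto
  then have freq: "\<exists>\<^sub>F n in sequentially. \<kappa> \<le> alpha n / sqrt n"
    by (simp add: not_eventually not_less less_imp_le[OF alpha] abs_of_nonneg)
  obtain K0 where K0: "\<forall>\<^sub>F n in sequentially.
      prob {\<omega> \<in> space M. K0 < alpha n * norm (est_error n \<omega>)} \<le> 1 / 4"
    using tight unfolding bounded_in_prob_def by (meson zero_less_divide_1_iff zero_less_numeral)
  define K where "K = max K0 0 / \<kappa>"
  have K: "0 \<le> K" "K0 \<le> K * \<kappa>" using \<kappa> by (auto simp: K_def)
  have "(\<lambda>p. sqrt (lam p) * (K + 1)) \<longlonglongrightarrow> sqrt 0 * (K + 1)"
    by (intro tendsto_intros eigenvalues_tendsto_zero)
  then have "\<forall>\<^sub>F p in sequentially. sqrt (lam p) * (K + 1) < sigma_eps / 16"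
    by (rule order_tendstoD) (use sigma_eps_pos in simp)
  then obtain p where p: "sqrt (lam p) * (K + 1) < sigma_eps / 16"
    by (auto simp: eventually_sequentially)
  have lam: "0 < lam p" by (rule lam_pos)
  obtain B where B: "\<forall>\<^sub>F n in sequentially. prob {\<omega> \<in> space M. B < fluctuation (e p) n \<omega>} \<le> 1 / 4"
    using bounded_in_prob_fluctuation[of "e p"] unfolding bounded_in_prob_def
    by (meson zero_less_divide_1_iff zero_less_numeral)
  obtain r q :: "nat \<Rightarrow> real" where rq: "r \<longlonglongrightarrow> 0" "q \<longlonglongrightarrow> 0"
    and expansion: "\<forall>\<^sub>F n in sequentially. 0 \<le> r n \<and> 0 \<le> q n \<and>
      (\<forall>\<omega>\<in>space M. fluctuation (e p) n \<omega> \<le> B \<longrightarrow>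
       sqrt n * \<bar>est_error n \<omega> \<bullet> Cov (Cov (e p)) - noise n \<omega> \<bullet> Cov (e p)\<bar>
         \<le> sqrt n * norm (est_error n \<omega>) * r n + q n)"
    by (rule root_n_error_expansion)
  have "(\<lambda>n. K * r n + q n) \<longlonglongrightarrow> K * 0 + 0"
    by (intro tendsto_intros rq)
  then have small: "\<forall>\<^sub>F n in sequentially. K * r n + q n < (lam p)\<^sup>2"
    by (rule order_tendstoD) (use lam in simp)
  have "\<forall>\<^sub>F n in sequentially.
      prob {\<omega> \<in> space M. sqrt n * \<bar>noise n \<omega> \<bullet> e p\<bar> \<le> (1 / 16) * (sigma_eps * sqrt (lam p))} < 4 * (1 / 16)"
    by (rule noise_eigenvector_small_ball) simp
  with K0 B expansion small have "\<forall>\<^sub>F n in sequentially. \<not> \<kappa> \<le> alpha n / sqrt n"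
    using eventually_gt_at_top[of 0]
  proof eventually_elim
    case (elim n)
    show ?case
    proof
      assume "\<kappa> \<le> alpha n / sqrt n"
      then have \<kappa>_le: "\<kappa> * sqrt n \<le> alpha n" using elim by (simp add: pos_le_divide_eq)
      have "sqrt n * \<bar>noise n \<omega> \<bullet> e p\<bar> \<le> (1 / 16) * (sigma_eps * sqrt (lam p))"
        if \<omega>: "\<omega> \<in> space M" and W: "alpha n * norm (est_error n \<omega>) \<le> K0"
          and fl: "fluctuation (e p) n \<omega> \<le> B" for \<omega>
      proof -
        have "\<kappa> * sqrt n * norm (est_error n \<omega>) \<le> alpha n * norm (est_error n \<omega>)"
          using \<kappa>_le by (intro mult_right_mono) auto
        also have "\<dots> \<le> K * \<kappa>" using W K by linarith
        finally have t: "sqrt n * norm (est_error n \<omega>) \<le> K"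
          using \<kappa> by (simp add: mult.commute mult.left_commute)
        have Cov1: "Cov (e p) = lam p *\<^sub>R e p" and Cov2: "Cov (Cov (e p)) = (lam p)\<^sup>2 *\<^sub>R e p"
          by (simp_all add: covariance_op_eigenvector covariance_op_scaleR power2_eq_square)
        have norm_e: "norm (e p) = 1" by (simp add: norm_eq_sqrt_inner eigenvector_orthonormal)
        have "\<bar>est_error n \<omega> \<bullet> e p\<bar> \<le> norm (est_error n \<omega>)"
          using Cauchy_Schwarz_ineq2[of "est_error n \<omega>" "e p"] norm_e by simp
        then have "sqrt n * \<bar>est_error n \<omega> \<bullet> e p\<bar> \<le> sqrt n * norm (est_error n \<omega>)"
          by (intro mult_left_mono) auto
        then have tp: "sqrt n * \<bar>est_error n \<omega> \<bullet> e p\<bar> \<le> K" using t by linarith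
        have "lam p * (sqrt n * \<bar>noise n \<omega> \<bullet> e p\<bar>) = sqrt n * \<bar>noise n \<omega> \<bullet> Cov (e p)\<bar>"
          using lam by (simp add: Cov1 abs_mult)
        also have "\<dots> \<le> sqrt n * (\<bar>est_error n \<omega> \<bullet> Cov (Cov (e p))\<bar>
            + \<bar>est_error n \<omega> \<bullet> Cov (Cov (e p)) - noise n \<omega> \<bullet> Cov (e p)\<bar>)"
          by (intro mult_left_mono) auto
        also have "\<dots> \<le> (lam p)\<^sup>2 * (sqrt n * \<bar>est_error n \<omega> \<bullet> e p\<bar>)
            + (sqrt n * norm (est_error n \<omega>) * r n + q n)"
          using elim \<omega> fl by (simp add: distrib_left Cov2 abs_mult mult.left_commute)
        also have "\<dots> \<le> (lam p)\<^sup>2 * K + (K * r n + q n)"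
          using elim tp t by (intro add_mono mult_left_mono mult_right_mono) auto
        also have "\<dots> \<le> (lam p)\<^sup>2 * (K + 1)" using elim by (simp add: distrib_left)
        finally have "sqrt n * \<bar>noise n \<omega> \<bullet> e p\<bar> \<le> lam p * (K + 1)"
          using lam by (simp add: power2_eq_square mult.assoc)
        also have "\<dots> = sqrt (lam p) * (sqrt (lam p) * (K + 1))" using lam by simp
        also have "\<dots> \<le> sqrt (lam p) * (sigma_eps / 16)"
          using p lam by (intro mult_left_mono) auto
        finally show ?thesis by (simp add: mult.commute)
      qed
      then have "space M \<subseteq> {\<omega> \<in> space M. K0 < alpha n * norm (est_error n \<omega>)}
          \<union> {\<omega> \<in> space M. B < fluctuation (e p) n \<omega>}
          \<union> {\<omega> \<in> space M. sqrt n * \<bar>noise n \<omega> \<bullet> e p\<bar> \<le> (1 / 16) * (sigma_eps * sqrt (lam p))}"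
        (is "_ \<subseteq> ?A1 \<union> ?A2 \<union> ?A3") unfolding not_le[symmetric] by blast
      then have "prob (space M) \<le> prob (?A1 \<union> ?A2 \<union> ?A3)"
        by (intro finite_measure_mono) auto
      also have "\<dots> \<le> prob (?A1 \<union> ?A2) + prob ?A3" by (intro measure_Un_le) auto
      also have "\<dots> \<le> prob ?A1 + prob ?A2 + prob ?A3" by (intro add_mono measure_Un_le) auto
      finally show False using elim by (simp add: prob_space)
    qed
  qed
  then show False using freq by (simp add: frequently_def)
qed

text \<open>By the expansion and the bounds in probability, \<open>\<langle>\<alpha>\<^sub>n T\<^sub>n, \<Gamma> (\<Gamma> k)\<rangle>\<close> tends to 0 in
  probability, and the bounded continuous function \<open>g\<close> below transfers this to \<open>Z\<close>.\<close>
lemma limit_zero_if_slower_than_root_n: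
  assumes alpha: "\<And>n. 0 < alpha n" and slow: "(\<lambda>n. alpha n / sqrt n) \<longlonglongrightarrow> 0"
    and conv: "converges_in_distribution M (\<lambda>n \<omega>. alpha n *\<^sub>R est_error n \<omega>) N Z"
    and N: "prob_space N"
  shows "AE v in N. Z v \<bullet> Cov (Cov k) = 0"
proof -
  interpret N: prob_space N by fact
  define W where "W n \<omega> = alpha n *\<^sub>R est_error n \<omega>" for n \<omega>
  have conv': "converges_in_distribution M W N Z" using conv by (simp add: W_def[abs_def])
  have [measurable]: "W n \<in> borel_measurable M" "Z \<in> borel_measurable N" for n
    using conv' by (auto simp: converges_in_distribution_def)
  define g where "g x = min 1 \<bar>x \<bullet> Cov (Cov k)\<bar>" for x
  have g: "0 \<le> g x" "g x \<le> 1" "g x \<le> \<bar>x \<bullet> Cov (Cov k)\<bar>" for x by (auto simp: g_def)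
  have g_cont: "continuous_on UNIV g"
    unfolding g_def by (intro continuous_intros)
  have g_bdd: "bounded (range g)"
    using g by (intro boundedI[of _ 1]) auto
  have [measurable]: "g \<in> borel_measurable borel"
    using g_cont by (rule borel_measurable_continuous_onI)
  have lim: "(\<lambda>n. expectation (\<lambda>\<omega>. g (W n \<omega>))) \<longlonglongrightarrow> (\<integral>v. g (Z v) \<partial>N)"
    using conv' g_cont g_bdd by (auto simp: converges_in_distribution_def)
  have intZ: "integrable N (\<lambda>v. g (Z v))"
    by (rule N.integrable_const_bound[where B = 1]) (use g in auto)
  define V where "V n \<omega> = norm (W n \<omega>) + fluctuation k n \<omega>" for n \<omega>
  have [measurable]: "V n \<in> borel_measurable M" for n unfolding V_def by measurable
  have V: "bounded_in_prob V"
    unfolding V_def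
    by (intro bounded_in_prob_add bounded_in_prob_fluctuation
        converges_in_distribution_bounded_in_prob[OF conv' N]) measurable
  have le: "(\<integral>v. g (Z v) \<partial>N) \<le> \<tau>" if \<tau>: "\<tau> > 0" for \<tau>
  proof -
    obtain B0 where B0: "\<forall>\<^sub>F n in sequentially. prob {\<omega> \<in> space M. B0 < V n \<omega>} \<le> \<tau>"
      using V \<tau> unfolding bounded_in_prob_def by blast
    define B where "B = max B0 0"
    obtain p q :: "nat \<Rightarrow> real" where pq: "p \<longlonglongrightarrow> 0" "q \<longlonglongrightarrow> 0"
      and expansion: "\<forall>\<^sub>F n in sequentially. 0 \<le> p n \<and> 0 \<le> q n \<and>
        (\<forall>\<omega>\<in>space M. fluctuation k n \<omega> \<le> B \<longrightarrow>
         sqrt n * \<bar>est_error n \<omega> \<bullet> Cov (Cov k) - noise n \<omega> \<bullet> Cov k\<bar>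
           \<le> sqrt n * norm (est_error n \<omega>) * p n + q n)"
      by (rule root_n_error_expansion)
    define r where "r n = B * p n + (alpha n / sqrt n) * (q n + B * norm (Cov k))" for n
    have "(\<lambda>n. \<tau> + r n) \<longlonglongrightarrow> \<tau> + (B * 0 + 0 * (0 + B * norm (Cov k)))"
      unfolding r_def by (intro tendsto_intros pq slow)
    then have r_lim: "(\<lambda>n. \<tau> + r n) \<longlonglongrightarrow> \<tau>" by simp
    have "\<forall>\<^sub>F n in sequentially. expectation (\<lambda>\<omega>. g (W n \<omega>)) \<le> \<tau> + r n"
      using B0 expansion eventually_gt_at_top[of 0]
    proof eventually_elim
      case (elim n)
      have r_nonneg: "0 \<le> r n"
        unfolding r_def using elim less_imp_le[OF alpha[of n]] by (simp add: B_def)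
      let ?A = "{\<omega> \<in> space M. B0 < V n \<omega>}"
      have pw: "g (W n \<omega>) \<le> indicator ?A \<omega> + r n" if \<omega>: "\<omega> \<in> space M" for \<omega>
      proof (cases "B0 < V n \<omega>")
        case True
        then show ?thesis using \<omega> g(2)[of "W n \<omega>"] r_nonneg by simp
      next
        case False
        have nn: "0 \<le> sqrt n * norm x" for x :: 'h by simp
        have fl0: "0 \<le> fluctuation k n \<omega>" unfolding fluctuation_def by simp
        have VB: "norm (W n \<omega>) + fluctuation k n \<omega> \<le> B"
          using False by (simp add: V_def B_def)
        then have WB: "norm (W n \<omega>) \<le> B" and fl: "fluctuation k n \<omega> \<le> B"
          using fl0 norm_ge_zero[of "W n \<omega>"] by linarith+
        have noise: "sqrt n * norm (noise n \<omega>) \<le> B"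
          using fl nn[of "Cov_n n \<omega> (Cov k) - Cov (Cov k)"]
          nn[of "Cov_n n \<omega> k - Cov k"] nn[of "Cov_n n \<omega> rho - Cov rho"]
          unfolding fluctuation_def by linarith
        have nC: "sqrt n * \<bar>noise n \<omega> \<bullet> Cov k\<bar> \<le> B * norm (Cov k)"
        proof -
          have "sqrt n * \<bar>noise n \<omega> \<bullet> Cov k\<bar> \<le> sqrt n * (norm (noise n \<omega>) * norm (Cov k))"
            by (intro mult_left_mono Cauchy_Schwarz_ineq2) auto
          also have "\<dots> \<le> B * norm (Cov k)"
            using noise by (simp add: mult.assoc[symmetric] mult_right_mono)
          finally show ?thesis .
        qed
        have a: "0 \<le> alpha n / sqrt n" using less_imp_le[OF alpha[of n]] by simp
        have W: "norm (W n \<omega>) = (alpha n / sqrt n) * (sqrt n * norm (est_error n \<omega>))"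
          using elim less_imp_le[OF alpha[of n]] by (simp add: W_def)
        have "\<bar>W n \<omega> \<bullet> Cov (Cov k)\<bar> = (alpha n / sqrt n) * (sqrt n * \<bar>est_error n \<omega> \<bullet> Cov (Cov k)\<bar>)"
          using elim less_imp_le[OF alpha[of n]] by (simp add: W_def abs_mult)
        also have "\<dots> \<le> (alpha n / sqrt n) * (sqrt n *
            (\<bar>est_error n \<omega> \<bullet> Cov (Cov k) - noise n \<omega> \<bullet> Cov k\<bar> + \<bar>noise n \<omega> \<bullet> Cov k\<bar>))"
          by (intro mult_left_mono a) auto
        also have "\<dots> \<le> (alpha n / sqrt n) *
            (sqrt n * norm (est_error n \<omega>) * p n + q n + B * norm (Cov k))"
        proof (intro mult_left_mono a)
          have "sqrt n * \<bar>est_error n \<omega> \<bullet> Cov (Cov k) - noise n \<omega> \<bullet> Cov k\<bar>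
              \<le> sqrt n * norm (est_error n \<omega>) * p n + q n"
            using elim \<omega> fl by blast
          then show "sqrt n *
            (\<bar>est_error n \<omega> \<bullet> Cov (Cov k) - noise n \<omega> \<bullet> Cov k\<bar> + \<bar>noise n \<omega> \<bullet> Cov k\<bar>)
            \<le> sqrt n * norm (est_error n \<omega>) * p n + q n + B * norm (Cov k)"
            using nC unfolding distrib_left by linarith
        qed
        also have "\<dots> = norm (W n \<omega>) * p n + (alpha n / sqrt n) * (q n + B * norm (Cov k))"
          unfolding W by (simp add: algebra_simps)
        also have "\<dots> \<le> r n"
          unfolding r_def using WB elim by (intro add_right_mono mult_right_mono) auto
        finally show ?thesis
          using g(3)[of "W n \<omega>"] by (simp add: indicator_def)
      qed
      have "expectation (\<lambda>\<omega>. g (W n \<omega>)) \<le> expectation (\<lambda>\<omega>. indicator ?A \<omega> + r n)"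
      proof (rule integral_mono)
        show "integrable M (\<lambda>\<omega>. g (W n \<omega>))"
          by (rule integrable_const_bound[where B = 1]) (use g in auto)
      qed (use pw in \<open>auto simp: less_top[symmetric]\<close>)
      also have "\<dots> = prob ?A + r n"
        by (subst Bochner_Integration.integral_add)
          (auto simp: prob_space Int_def conj_commute less_top[symmetric])
      finally show ?case using elim by linarith
    qed
    then show ?thesis by (rule tendsto_le[OF sequentially_bot r_lim lim])
  qed
  have "(\<integral>v. g (Z v) \<partial>N) \<le> 0" by (rule field_le_epsilon) (use le in simp)
  moreover have "0 \<le> (\<integral>v. g (Z v) \<partial>N)" using g by simp
  ultimately have "(\<integral>v. g (Z v) \<partial>N) = 0" by simp
  then have "AE v in N. g (Z v) = 0"
    by (subst (asm) integral_nonneg_eq_0_iff_AE[OF intZ]) (use g in auto)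
  then show ?thesis by eventually_elim (auto simp: g_def min_def split: if_splits)
qed

end

theorem theorem4p1:
  fixes M :: "'w measure" and N :: "'v measure"
    and X :: "'w \<Rightarrow> 'h::{real_inner, banach, second_countable_topology}"
    and Y :: "'w \<Rightarrow> real"
    and lam :: "nat \<Rightarrow> real" and e :: "nat \<Rightarrow> 'h" and sigma_eps :: real
    and Xs :: "nat \<Rightarrow> 'w \<Rightarrow> 'h" and Ys :: "nat \<Rightarrow> 'w \<Rightarrow> real"
    and c :: "nat \<Rightarrow> real" and f :: "nat \<Rightarrow> real \<Rightarrow> real"
    and lhat :: "nat \<Rightarrow> 'w \<Rightarrow> nat \<Rightarrow> real" and ehat :: "nat \<Rightarrow> 'w \<Rightarrow> nat \<Rightarrow> 'h"
    and alpha :: "nat \<Rightarrow> real" and Z :: "'v \<Rightarrow> 'h"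
  assumes model: "functional_linear_model M X Y lam e sigma_eps"
    and sample: "iid_copies M X Y Xs Ys"
    and scheme: "regularization_scheme lam c f"
    and empirical_eigen:
      "\<And>n \<omega>. \<omega> \<in> space M \<Longrightarrow> eigensystem (empirical_cov Xs n \<omega>) (lhat n \<omega>) (ehat n \<omega>)"
    and fourth_moment: "integrable M (\<lambda>\<omega>. (norm (X \<omega>)) ^ 4)"
    and kernel: "{h. covariance_op M X h = 0} = {0}"
    and rate: "(\<lambda>n. SUP s\<in>{c n..}. \<bar>s * f n s - 1\<bar>) \<in> o(\<lambda>n. 1 / sqrt (real n))"
    and alpha_pos: "\<And>n. 0 < alpha n"
    and alpha_mono: "incseq alpha"
    and alpha_limit: "filterlim alpha at_top sequentially"
    and limit_space: "prob_space N"
    and convergence: "converges_in_distribution M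
      (\<lambda>n \<omega>. alpha n *\<^sub>R (slope_estimator Xs Ys f lhat ehat n \<omega> - slope M X Y lam e)) N Z"
  shows "degenerate N Z"
proof -
  interpret functional_linear_model M X Y lam e sigma_eps by (rule model)
  interpret regularization_scheme lam c f by (rule scheme)
  interpret slope_estimation M X Y lam e sigma_eps c f Xs Ys lhat ehat
    by unfold_locales (fact sample empirical_eigen fourth_moment rate)+
  have conv: "converges_in_distribution M (\<lambda>n \<omega>. alpha n *\<^sub>R est_error n \<omega>) N Z"
    using convergence by (simp add: est_error_def)
  have meas: "est_error n \<in> borel_measurable M" for n
  proof -
    have "(\<lambda>\<omega>. alpha n *\<^sub>R est_error n \<omega>) \<in> borel_measurable M"
      using conv by (simp add: converges_in_distribution_def)
    from borel_measurable_scaleR[OF borel_measurable_const[of "1 / alpha n"] this]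
    show ?thesis using alpha_pos[of n] by simp
  qed
  have tight: "bounded_in_prob (\<lambda>n \<omega>. alpha n * norm (est_error n \<omega>))"
    using converges_in_distribution_bounded_in_prob[OF conv limit_space] less_imp_le[OF alpha_pos]
    by simp
  have slow: "(\<lambda>n. alpha n / sqrt n) \<longlonglongrightarrow> 0"
    by (rule normalization_slower_than_root_n[OF alpha_pos tight meas])
  obtain D :: "'h set" where D: "countable D" "\<And>S. open S \<Longrightarrow> S \<noteq> {} \<Longrightarrow> \<exists>d\<in>D. d \<in> S"
    using countable_dense_exists by metis
  have "AE v in N. \<forall>k\<in>D. Z v \<bullet> Cov (Cov k) = 0"
    by (subst AE_ball_countable[OF D(1)])
      (use limit_zero_if_slower_than_root_n[OF alpha_pos slow conv limit_space] in blast)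
  then have "AE v in N. Z v = 0"
  proof eventually_elim
    case (elim v)
    define u where "u = Cov (Cov (Z v))"
    have u: "u \<bullet> k = 0" if "k \<in> D" for k
      using elim that by (simp add: u_def covariance_op_symmetric)
    have "u = 0"
    proof (rule ccontr)
      assume "u \<noteq> 0"
      then obtain d where d: "d \<in> D" "dist u d < norm u"
        using D(2)[of "ball u (norm u)"] by auto
      \<comment> \<open>\<open>d\<close> is orthogonal to \<open>u\<close>, so it cannot be closer to \<open>u\<close> than 0 is\<close>
      have "(norm u)\<^sup>2 \<le> (norm (u - d))\<^sup>2"
        using u[OF d(1)] by (simp add: power2_norm_eq_inner inner_diff_left inner_diff_right inner_commute[of d u])
      then show False using d(2) by (simp add: dist_norm power2_le_iff_abs_le)
    qed
    then show "Z v = 0" using kernel by (auto simp: u_def)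
  qed
  then show ?thesis by (auto simp: degenerate_def)
qed

end
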